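(* Let $k$ be a field and let $d\ge 2$, $m\ge 2$ be integers. Let $j$ be a positive integer, and let $\mathbf{b}\in\mathbb{N}\mathcal{A}$ with $|\mathbf{b}|=dj$. Put $A_j=\sum_{i=1}^{\min(j,n)}\mathbf{a}^i_0$. If $\mathbf{b}_0\ge A_j$, then $\beta_{p,\mathbf{b}}=0$ for all $p\in\mathbb{Z}$.
   Context: $\mathbb{N}$ includes $0$; coordinates of vectors in $\mathbb{Z}^{m+1}$ are indexed $0,1,\dots,m$, and $|\mathbf{a}|=\mathbf{a}_0+\dots+\mathbf{a}_m$. Let $\mathcal{A}=\{\mathbf{a}\in\mathbb{N}^{m+1}: |\mathbf{a}|=d\}$, which has $n=\binom{d+m}{m}$ elements. They are listed as $\mathbf{a}^1,\dots,\mathbf{a}^n$ in lexicographic order with the lexicographically largest first, so $\mathbf{a}^1=(d,0,\dots,0)$, $\mathbf{a}^2=(d-1,1,0,\dots,0)$, ..., $\mathbf{a}^n=(0,\dots,0,d)$; in particular $\mathbf{a}^1_0\ge\mathbf{a}^2_0\ge\dots\ge\mathbf{a}^n_0$. $\mathbb{N}\mathcal{A}\subset\mathbb{N}^{m+1}$ is the semigroup (with $\mathbf{0}$) generated by $\mathcal{A}$, i.e. the set of $\mathbf{b}\in\mathbb{N}^{m+1}$ with $d\mid|\mathbf{b}|$. Let $S=k[x_1,\dots,x_n]$ with the $\mathbb{Z}^{m+1}$-grading $\deg(x_i)=\mathbf{a}^i$. The semigroup ring $k[\mathbb{N}\mathcal{A}]$ (the $d$-th Veronese subring of $k[y_0,\dots,y_m]$)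 is a $\mathbb{Z}^{m+1}$-graded $S$-module via $x_i\mapsto \mathbf{y}^{\mathbf{a}^i}$. The multigraded Betti number is $\beta_{p,\mathbf{b}}=\beta_{p,\mathbf{b}}(k[\mathbb{N}\mathcal{A}])=\dim_k \mathrm{Tor}^S_p(k[\mathbb{N}\mathcal{A}],k)_{\mathbf{b}}$ (zero for $p<0$). *)

theory Defs
  imports Complex_Main "HOL-Library.Poly_Mapping" "HOL-Library.Extended_Nat"
    "HOL-Library.Countable_Set"
begin

text \<open>
  A finitely supported function of type \<open>'i \<Rightarrow>\<^sub>0 'r\<close> serves in four roles: as a vector of
  \<open>\<int>\<^sup>m\<^sup>+\<^sup>1\<close> (\<open>nat \<Rightarrow>\<^sub>0 int\<close>, with support in \<open>{..m}\<close>), as a polynomial in the variables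
  \<open>x\<^sub>i\<close> (\<open>(nat \<Rightarrow>\<^sub>0 nat) \<Rightarrow>\<^sub>0 'k\<close>), as an element of a semigroup ring, where the library
  multiplication is convolution (\<open>(nat \<Rightarrow>\<^sub>0 int) \<Rightarrow>\<^sub>0 'k\<close>), and as an element of the free
  module on a set of basis indices.
\<close>

type_synonym zvec = "nat \<Rightarrow>\<^sub>0 int"
type_synonym 'k polyx = "(nat \<Rightarrow>\<^sub>0 nat) \<Rightarrow>\<^sub>0 'k"
type_synonym 'k semiring_elem = "zvec \<Rightarrow>\<^sub>0 'k"

abbreviation lookup :: "('a \<Rightarrow>\<^sub>0 'b::zero) \<Rightarrow> 'a \<Rightarrow> 'b" where
  "lookup \<equiv> Poly_Mapping.lookup"
abbreviation keys :: "('a \<Rightarrow>\<^sub>0 'b::zero) \<Rightarrow> 'a set" where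
  "keys \<equiv> Poly_Mapping.keys"
abbreviation single :: "'a \<Rightarrow> 'b::zero \<Rightarrow> ('a \<Rightarrow>\<^sub>0 'b)" where
  "single \<equiv> Poly_Mapping.single"

definition smult :: "'r::semiring_0 \<Rightarrow> ('i \<Rightarrow>\<^sub>0 'r) \<Rightarrow> ('i \<Rightarrow>\<^sub>0 'r)" where
  "smult r v = Poly_Mapping.map ((*) r) v"

definition lin_ext :: "('i \<Rightarrow> ('j \<Rightarrow>\<^sub>0 'r::comm_semiring_0)) \<Rightarrow> ('i \<Rightarrow>\<^sub>0 'r) \<Rightarrow> ('j \<Rightarrow>\<^sub>0 'r)" where
  "lin_ext g v = (\<Sum>i\<in>keys v. smult (lookup v i) (g i))"


subsection \<open>The configuration and its semigroup\<close>

definition zlattice :: "nat \<Rightarrow> zvec set" where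
  "zlattice m = {c. keys c \<subseteq> {..m}}"

definition coord_sum :: "nat \<Rightarrow> zvec \<Rightarrow> int" where
  "coord_sum m c = (\<Sum>i\<le>m. lookup c i)"

definition gens :: "nat \<Rightarrow> nat \<Rightarrow> zvec set" where
  "gens m d = {a \<in> zlattice m. (\<forall>i. 0 \<le> lookup a i) \<and> coord_sum m a = int d}"

definition ngens :: "nat \<Rightarrow> nat \<Rightarrow> nat" where
  "ngens m d = card (gens m d)"

text \<open>
  The library order on \<open>nat \<Rightarrow>\<^sub>0 int\<close> is the lexicographic one, coordinate \<open>0\<close> being
  the most significant. The list is therefore lexicographically descending, and \<open>gen m d i\<close>
  is \<open>\<^bold>a\<^sup>i\<close> for \<open>1 \<le> i \<le> n\<close>.
\<close>

definition gen :: "nat \<Rightarrow> nat \<Rightarrow> nat \<Rightarrow> zvec" where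
  "gen m d i = rev (sorted_list_of_set (gens m d)) ! (i - 1)"

inductive_set semigroup_gen :: "nat \<Rightarrow> nat \<Rightarrow> zvec set" for m d where
  zero: "0 \<in> semigroup_gen m d"
| add: "a \<in> gens m d \<Longrightarrow> b \<in> semigroup_gen m d \<Longrightarrow> a + b \<in> semigroup_gen m d"


subsection \<open>The polynomial ring and the semigroup ring\<close>

definition poly_ring :: "nat \<Rightarrow> nat \<Rightarrow> 'k::field polyx set" where
  "poly_ring m d = {f. \<forall>t\<in>keys f. keys t \<subseteq> {1..ngens m d}}"

definition mon_deg :: "nat \<Rightarrow> nat \<Rightarrow> (nat \<Rightarrow>\<^sub>0 nat) \<Rightarrow> zvec" where
  "mon_deg m d t = (\<Sum>i\<in>keys t. smult (int (lookup t i)) (gen m d i))"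

definition semigroup_ring :: "nat \<Rightarrow> nat \<Rightarrow> 'k::field semiring_elem set" where
  "semigroup_ring m d = {g. keys g \<subseteq> semigroup_gen m d}"

definition coord_map :: "nat \<Rightarrow> nat \<Rightarrow> 'k::field polyx \<Rightarrow> 'k semiring_elem" where
  "coord_map m d f = (\<Sum>t\<in>keys f. single (mon_deg m d t) (lookup f t))"


subsection \<open>Multigraded free resolutions of the semigroup ring\<close>

text \<open>
  The module in homological degree \<open>p\<close> is free on \<open>basis F p\<close>, the basis element \<open>i\<close> having
  multidegree \<open>shift F p i\<close>. The differential out of homological degree \<open>p + 1\<close> sends the
  basis element \<open>i\<close> to \<open>diff F p i\<close>, and the augmentation sends the basis element \<open>i\<close> in
  homological degree \<open>0\<close> to \<open>aug F i\<close>. Since the semigroup ring has countable dimension over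
  the field, resolutions by free modules of countable rank exist, and natural numbers suffice
  as basis indices.
\<close>

record (overloaded) 'k free_complex =
  basis :: "nat \<Rightarrow> nat set"
  shift :: "nat \<Rightarrow> nat \<Rightarrow> zvec"
  diff :: "nat \<Rightarrow> nat \<Rightarrow> (nat \<Rightarrow>\<^sub>0 'k polyx)"
  aug :: "nat \<Rightarrow> 'k semiring_elem"

definition free_module :: "nat \<Rightarrow> nat \<Rightarrow> nat set \<Rightarrow> (nat \<Rightarrow>\<^sub>0 'k::field polyx) set" where
  "free_module m d J = {v. keys v \<subseteq> J \<and> (\<forall>i. lookup v i \<in> poly_ring m d)}"

definition homogeneous ::
    "nat \<Rightarrow> nat \<Rightarrow> (nat \<Rightarrow> zvec) \<Rightarrow> zvec \<Rightarrow> (nat \<Rightarrow>\<^sub>0 'k::field polyx) \<Rightarrow> bool" where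
  "homogeneous m d s c v \<longleftrightarrow> (\<forall>i. \<forall>t\<in>keys (lookup v i). mon_deg m d t + s i = c)"

definition aug_map ::
    "nat \<Rightarrow> nat \<Rightarrow> (nat \<Rightarrow> 'k semiring_elem) \<Rightarrow> (nat \<Rightarrow>\<^sub>0 'k::field polyx) \<Rightarrow> 'k semiring_elem" where
  "aug_map m d e v = (\<Sum>i\<in>keys v. coord_map m d (lookup v i) * e i)"

definition free_resolution :: "nat \<Rightarrow> nat \<Rightarrow> 'k::field free_complex \<Rightarrow> bool" where
  "free_resolution m d F \<longleftrightarrow>
     (\<forall>p. \<forall>i\<in>basis F p. shift F p i \<in> zlattice m) \<and>
     (\<forall>i\<in>basis F 0. aug F i \<in> semigroup_ring m d \<and> keys (aug F i) \<subseteq> {shift F 0 i}) \<and>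
     (\<forall>p. \<forall>i\<in>basis F (Suc p). diff F p i \<in> free_module m d (basis F p) \<and>
        homogeneous m d (shift F p) (shift F (Suc p) i) (diff F p i)) \<and>
     aug_map m d (aug F) ` free_module m d (basis F 0) = semigroup_ring m d \<and>
     lin_ext (diff F 0) ` free_module m d (basis F 1) =
       {v \<in> free_module m d (basis F 0). aug_map m d (aug F) v = 0} \<and>
     (\<forall>p. lin_ext (diff F (Suc p)) ` free_module m d (basis F (Suc (Suc p))) =
       {v \<in> free_module m d (basis F (Suc p)). lin_ext (diff F p) v = 0})"


subsection \<open>Tor and multigraded Betti numbers\<close>

text \<open>
  Here \<open>k = S / (x\<^sub>1, \<dots>, x\<^sub>n)\<close>. Tensoring the free module on \<open>basis F p\<close> with \<open>k\<close> gives the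
  \<open>k\<close>-vector space on \<open>basis F p\<close>, and tensoring a map given by a matrix of polynomials gives
  the matrix of their constant terms.
\<close>

definition diff_k :: "'k::field free_complex \<Rightarrow> nat \<Rightarrow> (nat \<Rightarrow>\<^sub>0 'k) \<Rightarrow> (nat \<Rightarrow>\<^sub>0 'k)" where
  "diff_k F p = lin_ext (\<lambda>i. Poly_Mapping.map (\<lambda>f. lookup f 0) (diff F p i))"

definition chains_k :: "'k::field free_complex \<Rightarrow> nat \<Rightarrow> zvec \<Rightarrow> (nat \<Rightarrow>\<^sub>0 'k) set" where
  "chains_k F p b = {v. keys v \<subseteq> {i \<in> basis F p. shift F p i = b}}"

definition cycles_k :: "'k::field free_complex \<Rightarrow> nat \<Rightarrow> zvec \<Rightarrow> (nat \<Rightarrow>\<^sub>0 'k) set" where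
  "cycles_k F p b = {v \<in> chains_k F p b. p = 0 \<or> diff_k F (p - 1) v = 0}"

definition boundaries_k :: "'k::field free_complex \<Rightarrow> nat \<Rightarrow> zvec \<Rightarrow> (nat \<Rightarrow>\<^sub>0 'k) set" where
  "boundaries_k F p b = diff_k F p ` chains_k F (Suc p) b"

text \<open>The dimension of \<open>Z / B\<close>, with value \<open>\<infinity>\<close> if it is not finite.\<close>

definition quotient_dim :: "('i \<Rightarrow>\<^sub>0 'k::field) set \<Rightarrow> ('i \<Rightarrow>\<^sub>0 'k) set \<Rightarrow> enat" where
  "quotient_dim Z B = Sup {enat (card X) | X. finite X \<and> X \<subseteq> Z \<and>
     (\<forall>c. (\<Sum>x\<in>X. smult (c x) x) \<in> B \<longrightarrow> (\<forall>x\<in>X. c x = 0))}"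

definition tor_dim :: "'k::field free_complex \<Rightarrow> nat \<Rightarrow> zvec \<Rightarrow> enat" where
  "tor_dim F p b = quotient_dim (cycles_k F p b) (boundaries_k F p b)"

text \<open>
  Tor is computed from an arbitrarily chosen multigraded free resolution; one exists by
  lemma \<open>ex_free_resolution\<close> below.
\<close>

definition multigraded_betti :: "'k::field itself \<Rightarrow> nat \<Rightarrow> nat \<Rightarrow> int \<Rightarrow> zvec \<Rightarrow> enat" where
  "multigraded_betti K m d p b =
     (if p < 0 then 0
      else tor_dim (SOME F :: 'k free_complex. free_resolution m d F) (nat p) b)"


subsection \<open>Existence of a multigraded free resolution\<close>


lemma lookup_smult [simp]: "lookup (smult r v) i = r * lookup v i"
  by (simp add: smult_def Poly_Mapping.map.rep_eq when_def)

lemma smult_add_right: "smult r (v + w) = smult r v + smult r w"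
  by (rule poly_mapping_eqI) (simp add: lookup_add algebra_simps)

lemma smult_add_left: "smult (r + q) v = smult r v + smult q v"
  by (rule poly_mapping_eqI) (simp add: lookup_add algebra_simps)

lemma smult_zero_left [simp]: "smult 0 v = 0"
  by (rule poly_mapping_eqI) simp

lemma smult_smult: "smult r (smult q v) = smult (r * q) v"
  by (rule poly_mapping_eqI) (simp add: mult.assoc)

lemma smult_sum_right: "smult r (\<Sum>i\<in>A. v i) = (\<Sum>i\<in>A. smult r (v i))"
  by (rule poly_mapping_eqI) (simp add: lookup_sum sum_distrib_left)

lemma lookup_lin_ext: "lookup (lin_ext g v) j = (\<Sum>i\<in>keys v. lookup v i * lookup (g i) j)"
  by (simp add: lin_ext_def lookup_sum)

lemma lin_ext_superset:
  assumes "finite T" "keys v \<subseteq> T"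
  shows "lin_ext g v = (\<Sum>i\<in>T. smult (lookup v i) (g i))"
  unfolding lin_ext_def
  by (rule sum.mono_neutral_left) (use assms in \<open>auto simp: in_keys_iff\<close>)

lemma lin_ext_add: "lin_ext g (v + w) = lin_ext g v + lin_ext g w"
proof -
  let ?T = "keys v \<union> keys w"
  have "lin_ext g (v + w) = (\<Sum>i\<in>?T. smult (lookup (v + w) i) (g i))"
    by (rule lin_ext_superset) (auto simp: keys_add)
  also have "\<dots> = (\<Sum>i\<in>?T. smult (lookup v i) (g i)) + (\<Sum>i\<in>?T. smult (lookup w i) (g i))"
    by (simp add: lookup_add smult_add_left sum.distrib)
  also have "\<dots> = lin_ext g v + lin_ext g w"
    by (simp add: lin_ext_superset[of ?T])
  finally show ?thesis .
qed

lemma lin_ext_smult: "lin_ext g (smult r v) = smult r (lin_ext g v)"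
proof -
  have "lin_ext g (smult r v) = (\<Sum>i\<in>keys v. smult (lookup (smult r v) i) (g i))"
    by (rule lin_ext_superset) (auto simp: in_keys_iff)
  thus ?thesis by (simp add: lin_ext_def smult_sum_right smult_smult)
qed

lemma lin_ext_zero [simp]: "lin_ext g 0 = 0"
  by (simp add: lin_ext_def)

lemma lin_ext_single:
  fixes r :: "'r::comm_semiring_0"
  shows "lin_ext g (single i r) = smult r (g i)"
  by (simp add: lin_ext_superset[of "{i}"])

lemma mon_deg_superset:
  assumes "finite T" "keys t \<subseteq> T"
  shows "mon_deg m d t = (\<Sum>i\<in>T. smult (int (lookup t i)) (gen m d i))"
  unfolding mon_deg_def
  by (rule sum.mono_neutral_left) (use assms in \<open>auto simp: in_keys_iff\<close>)

lemma mon_deg_add: "mon_deg m d (t + u) = mon_deg m d t + mon_deg m d u"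
proof -
  let ?T = "keys t \<union> keys u"
  have "mon_deg m d (t + u) = (\<Sum>i\<in>?T. smult (int (lookup (t + u) i)) (gen m d i))"
    by (rule mon_deg_superset) (auto simp: keys_add)
  also have "\<dots> = (\<Sum>i\<in>?T. smult (int (lookup t i)) (gen m d i))
      + (\<Sum>i\<in>?T. smult (int (lookup u i)) (gen m d i))"
    by (simp add: lookup_add smult_add_left sum.distrib)
  also have "\<dots> = mon_deg m d t + mon_deg m d u"
    by (simp add: mon_deg_superset[of ?T])
  finally show ?thesis .
qed

lemma mon_deg_zero [simp]: "mon_deg m d 0 = 0"
  by (simp add: mon_deg_def)

lemma finite_gens: "finite (gens m d)"
proof -
  let ?F = "{f. \<forall>x. (x \<in> {..m} \<longrightarrow> f x \<in> {0..int d}) \<and> (x \<notin> {..m} \<longrightarrow> f x = 0)}"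
  have "lookup a \<in> ?F" if "a \<in> gens m d" for a
  proof -
    have a: "keys a \<subseteq> {..m}" "\<forall>i. 0 \<le> lookup a i" "(\<Sum>i\<le>m. lookup a i) = int d"
      using that by (auto simp: gens_def zlattice_def coord_sum_def)
    have "lookup a i \<le> int d" if "i \<le> m" for i
      using member_le_sum[of i "{..m}" "lookup a"] a that by auto
    thus ?thesis using a by (auto simp: in_keys_iff)
  qed
  hence "lookup ` gens m d \<subseteq> ?F" by blast
  moreover have "finite ?F" by (rule finite_set_of_finite_funs) auto
  ultimately have "finite (lookup ` gens m d)" by (rule finite_subset)
  thus ?thesis by (rule finite_imageD) (simp add: inj_on_def)
qed

lemma gen_image: "gen m d ` {1..ngens m d} = gens m d"
proof -
  let ?l = "rev (sorted_list_of_set (gens m d))"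
  have l: "length ?l = ngens m d" by (simp add: ngens_def)
  have "gen m d ` {1..ngens m d} = gen m d ` Suc ` {..<ngens m d}"
    by (simp add: image_Suc_lessThan)
  also have "\<dots> = (!) ?l ` {..<length ?l}"
    unfolding l image_image by (simp add: gen_def)
  also have "\<dots> = set ?l" unfolding set_conv_nth by blast
  also have "\<dots> = gens m d" using finite_gens by simp
  finally show ?thesis .
qed

lemma gen_in_gens: "i \<in> {1..ngens m d} \<Longrightarrow> gen m d i \<in> gens m d"
  using imageI[of i "{1..ngens m d}" "gen m d"] by (simp only: gen_image)

lemma semigroup_gen_add:
  "b \<in> semigroup_gen m d \<Longrightarrow> c \<in> semigroup_gen m d \<Longrightarrow> b + c \<in> semigroup_gen m d"
proof (induction rule: semigroup_gen.induct)
  case (add a b)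
  show ?case unfolding add.assoc by (rule semigroup_gen.add[OF add(1) add(3)[OF add(4)]])
qed simp

lemma semigroup_gen_smult:
  assumes "a \<in> gens m d" shows "smult (int n) a \<in> semigroup_gen m d"
proof (induction n)
  case 0
  show ?case by (simp add: semigroup_gen.zero)
next
  case (Suc n)
  have "smult (int (Suc n)) a = a + smult (int n) a"
    by (rule poly_mapping_eqI) (simp add: lookup_add algebra_simps)
  thus ?case using semigroup_gen.add[OF assms Suc] by metis
qed

lemma semigroup_gen_sum:
  assumes "finite T" "\<And>i. i \<in> T \<Longrightarrow> f i \<in> semigroup_gen m d"
  shows "sum f T \<in> semigroup_gen m d"
  using assms
proof (induction rule: finite_induct)
  case (insert x F)
  thus ?case by (simp add: semigroup_gen_add)
qed (simp add: semigroup_gen.zero)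

lemma mon_deg_in_semigroup:
  assumes "keys t \<subseteq> {1..ngens m d}" shows "mon_deg m d t \<in> semigroup_gen m d"
  unfolding mon_deg_def
proof (rule semigroup_gen_sum)
  fix i assume "i \<in> keys t"
  hence "gen m d i \<in> gens m d" using assms by (intro gen_in_gens) blast
  thus "smult (int (lookup t i)) (gen m d i) \<in> semigroup_gen m d" by (rule semigroup_gen_smult)
qed simp

lemma semigroup_gen_mon_deg:
  "b \<in> semigroup_gen m d \<Longrightarrow> \<exists>t. keys t \<subseteq> {1..ngens m d} \<and> mon_deg m d t = b"
proof (induction rule: semigroup_gen.induct)
  case zero
  show ?case by (rule exI[of _ 0]) simp
next
  case (add a b)
  from add(3) obtain t where t: "keys t \<subseteq> {1..ngens m d}" "mon_deg m d t = b" by blast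
  obtain i where i: "i \<in> {1..ngens m d}" "gen m d i = a"
  proof -
    have "a \<in> gen m d ` {1..ngens m d}" unfolding gen_image by (rule add(1))
    thus ?thesis using that by (elim imageE) simp
  qed
  have "mon_deg m d (single i 1) = smult (int 1) (gen m d i)"
    using mon_deg_superset[of "{i}" "single i 1" m d] by simp
  also have "\<dots> = a" by (rule poly_mapping_eqI) (simp add: i)
  finally have "mon_deg m d (single i 1 + t) = a + b" by (simp add: mon_deg_add t)
  moreover have "keys (single i 1 + t) \<subseteq> {1..ngens m d}"
    using keys_add[of "single i 1" t] i t by auto
  ultimately show ?case by blast
qed

lemma zlattice_add: "b \<in> zlattice m \<Longrightarrow> c \<in> zlattice m \<Longrightarrow> b + c \<in> zlattice m"
  using keys_add[of b c] by (auto simp: zlattice_def)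

lemma semigroup_gen_zlattice: "b \<in> semigroup_gen m d \<Longrightarrow> b \<in> zlattice m"
proof (induction rule: semigroup_gen.induct)
  case (add a b)
  thus ?case by (intro zlattice_add) (simp add: gens_def)
qed (simp add: zlattice_def)

lemma poly_mapping_expand: "f = (\<Sum>t\<in>keys f. single t (lookup f t))"
  by (rule poly_mapping_eqI) (auto simp: lookup_sum lookup_single when_def in_keys_iff)

lemma coord_map_superset:
  assumes "finite T" "keys f \<subseteq> T"
  shows "coord_map m d f = (\<Sum>t\<in>T. single (mon_deg m d t) (lookup f t))"
  unfolding coord_map_def
  by (rule sum.mono_neutral_left) (use assms in \<open>auto simp: in_keys_iff\<close>)

lemma coord_map_add: "coord_map m d (f + g) = coord_map m d f + coord_map m d g"
proof -
  let ?T = "keys f \<union> keys g"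
  have "coord_map m d (f + g) = (\<Sum>t\<in>?T. single (mon_deg m d t) (lookup (f + g) t))"
    by (rule coord_map_superset) (auto simp: keys_add)
  also have "\<dots> = (\<Sum>t\<in>?T. single (mon_deg m d t) (lookup f t))
      + (\<Sum>t\<in>?T. single (mon_deg m d t) (lookup g t))"
    by (simp add: lookup_add single_add sum.distrib)
  also have "\<dots> = coord_map m d f + coord_map m d g"
    by (simp add: coord_map_superset[of ?T])
  finally show ?thesis .
qed

lemma coord_map_zero [simp]: "coord_map m d 0 = 0"
  by (simp add: coord_map_def)

lemma coord_map_single [simp]: "coord_map m d (single t a) = single (mon_deg m d t) a"
  by (simp add: coord_map_superset[of "{t}"])

lemma coord_map_sum: "coord_map m d (\<Sum>i\<in>A. f i) = (\<Sum>i\<in>A. coord_map m d (f i))"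
  by (induction A rule: infinite_finite_induct) (auto simp: coord_map_add)

lemma coord_map_mult: "coord_map m d (f * g) = coord_map m d f * coord_map m d g"
proof -
  have "f * g = (\<Sum>t\<in>keys f. \<Sum>u\<in>keys g. single (t + u) (lookup f t * lookup g u))"
    by (subst poly_mapping_expand[of f], subst poly_mapping_expand[of g])
       (simp add: sum_product mult_single)
  hence "coord_map m d (f * g)
      = (\<Sum>t\<in>keys f. \<Sum>u\<in>keys g. single (mon_deg m d (t + u)) (lookup f t * lookup g u))"
    by (simp add: coord_map_sum)
  also have "\<dots> = coord_map m d f * coord_map m d g"
    by (simp add: coord_map_def sum_product mult_single mon_deg_add)
  finally show ?thesis .
qed

lemma keys_coord_mapE:
  assumes "b \<in> keys (coord_map m d f)"
  obtains t where "t \<in> keys f" "b = mon_deg m d t"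
proof -
  have "b \<in> (\<Union>t\<in>keys f. keys (single (mon_deg m d t) (lookup f t)))"
    using assms keys_sum[of "\<lambda>t. single (mon_deg m d t) (lookup f t)" "keys f"]
    unfolding coord_map_def by blast
  then obtain t where "t \<in> keys f" "b \<in> keys (single (mon_deg m d t) (lookup f t))" by blast
  thus ?thesis using that by (simp split: if_splits)
qed

lemma aug_map_superset:
  assumes "finite T" "keys v \<subseteq> T"
  shows "aug_map m d e v = (\<Sum>i\<in>T. coord_map m d (lookup v i) * e i)"
  unfolding aug_map_def
  by (rule sum.mono_neutral_left) (use assms in \<open>auto simp: in_keys_iff\<close>)

lemma aug_map_add: "aug_map m d e (v + w) = aug_map m d e v + aug_map m d e w"
proof -
  let ?T = "keys v \<union> keys w"
  have "aug_map m d e (v + w) = (\<Sum>i\<in>?T. coord_map m d (lookup (v + w) i) * e i)"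
    by (rule aug_map_superset) (auto simp: keys_add)
  also have "\<dots> = (\<Sum>i\<in>?T. coord_map m d (lookup v i) * e i)
      + (\<Sum>i\<in>?T. coord_map m d (lookup w i) * e i)"
    by (simp add: lookup_add coord_map_add distrib_right sum.distrib)
  also have "\<dots> = aug_map m d e v + aug_map m d e w"
    by (simp add: aug_map_superset[of ?T])
  finally show ?thesis .
qed

lemma aug_map_smult: "aug_map m d e (smult f v) = coord_map m d f * aug_map m d e v"
proof -
  have "aug_map m d e (smult f v) = (\<Sum>i\<in>keys v. coord_map m d (lookup (smult f v) i) * e i)"
    by (rule aug_map_superset) (auto simp: in_keys_iff)
  thus ?thesis by (simp add: aug_map_def coord_map_mult sum_distrib_left mult.assoc)
qed


definition hom_comp ::
    "nat \<Rightarrow> nat \<Rightarrow> (nat \<Rightarrow> zvec) \<Rightarrow> zvec \<Rightarrow> (nat \<Rightarrow>\<^sub>0 'k::field polyx) \<Rightarrow> (nat \<Rightarrow>\<^sub>0 'k polyx)" where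
  "hom_comp m d s c v = (\<Sum>i\<in>keys v. \<Sum>t\<in>keys (lookup v i).
     if mon_deg m d t + s i = c then single i (single t (lookup (lookup v i) t)) else 0)"

lemma lookup_hom_comp:
  "lookup (lookup (hom_comp m d s c v) i) t
     = (if mon_deg m d t + s i = c then lookup (lookup v i) t else 0)"
proof -
  define x where "x = (if mon_deg m d t + s i = c then lookup (lookup v i) t else 0)"
  have "lookup (lookup (hom_comp m d s c v) i) t =
     (\<Sum>j\<in>keys v. \<Sum>u\<in>keys (lookup v j). if j = i then (if u = t then x else 0) else 0)"
    unfolding hom_comp_def lookup_sum
    by (intro sum.cong refl) (auto simp: lookup_single when_def x_def)
  also have "\<dots> = (\<Sum>j\<in>keys v. if j = i then (if t \<in> keys (lookup v j) then x else 0) else 0)"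
    by (intro sum.cong refl) auto
  also have "\<dots> = (if i \<in> keys v then (if t \<in> keys (lookup v i) then x else 0) else 0)"
    by (simp add: sum.delta)
  also have "\<dots> = x"
    by (auto simp: in_keys_iff x_def)
  finally show ?thesis by (simp add: x_def)
qed

lemma poly_mapping_eqI2: "(\<And>i t. lookup (lookup v i) t = lookup (lookup w i) t) \<Longrightarrow> v = w"
  by (intro poly_mapping_eqI) auto

lemma homogeneous_iff:
  "homogeneous m d s c v \<longleftrightarrow> (\<forall>i t. lookup (lookup v i) t \<noteq> 0 \<longrightarrow> mon_deg m d t + s i = c)"
  by (auto simp: homogeneous_def in_keys_iff)

lemma homogeneous_hom_comp: "homogeneous m d s c (hom_comp m d s c v)"
  by (auto simp: homogeneous_iff lookup_hom_comp split: if_splits)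

lemma hom_comp_add: "hom_comp m d s c (v + w) = hom_comp m d s c v + hom_comp m d s c w"
  by (rule poly_mapping_eqI2) (simp add: lookup_hom_comp lookup_add)

lemma hom_comp_zero [simp]: "hom_comp m d s c 0 = 0"
  by (simp add: hom_comp_def)

lemma hom_comp_sum: "hom_comp m d s c (\<Sum>x\<in>A. f x) = (\<Sum>x\<in>A. hom_comp m d s c (f x))"
  by (induction A rule: infinite_finite_induct) (auto simp: hom_comp_add)

lemma hom_comp_homogeneous:
  "homogeneous m d s c' v \<Longrightarrow> hom_comp m d s c v = (if c = c' then v else 0)"
  by (rule poly_mapping_eqI2) (auto simp: lookup_hom_comp homogeneous_iff)

definition degrees :: "nat \<Rightarrow> nat \<Rightarrow> (nat \<Rightarrow> zvec) \<Rightarrow> (nat \<Rightarrow>\<^sub>0 'k::field polyx) \<Rightarrow> zvec set" where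
  "degrees m d s v = (\<Union>i\<in>keys v. (\<lambda>t. mon_deg m d t + s i) ` keys (lookup v i))"

lemma finite_degrees: "finite (degrees m d s v)"
  by (simp add: degrees_def)

lemma degreesI: "lookup (lookup v i) t \<noteq> 0 \<Longrightarrow> mon_deg m d t + s i \<in> degrees m d s v"
proof -
  assume t: "lookup (lookup v i) t \<noteq> 0"
  hence "lookup v i \<noteq> 0" by auto
  hence "i \<in> keys v" "t \<in> keys (lookup v i)" using t by (simp_all add: in_keys_iff)
  thus ?thesis unfolding degrees_def by blast
qed

lemma hom_comp_outside: "c \<notin> degrees m d s v \<Longrightarrow> hom_comp m d s c v = 0"
  by (rule poly_mapping_eqI2) (use degreesI[of v _ _ m d s] in \<open>auto simp: lookup_hom_comp\<close>)

lemma hom_comp_decomp: "v = (\<Sum>c\<in>degrees m d s v. hom_comp m d s c v)"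
proof (rule poly_mapping_eqI2)
  fix i t
  show "lookup (lookup v i) t = lookup (lookup (\<Sum>c\<in>degrees m d s v. hom_comp m d s c v) i) t"
  proof (cases "lookup (lookup v i) t = 0")
    case True
    thus ?thesis by (simp add: lookup_sum lookup_hom_comp sum.neutral)
  next
    case False
    from degreesI[OF False] show ?thesis
      by (simp add: lookup_sum lookup_hom_comp finite_degrees)
  qed
qed

lemma poly_ring_mult:
  assumes "f \<in> poly_ring m d" "g \<in> poly_ring m d" shows "f * g \<in> poly_ring m d"
  unfolding poly_ring_def
proof (intro CollectI ballI)
  fix t assume "t \<in> keys (f * g)"
  then obtain a b where t: "t = a + b" "a \<in> keys f" "b \<in> keys g"
    using keys_mult[of f g] by auto
  have "keys a \<subseteq> {1..ngens m d}" using assms(1) t(2) unfolding poly_ring_def by blast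
  moreover have "keys b \<subseteq> {1..ngens m d}" using assms(2) t(3) unfolding poly_ring_def by blast
  ultimately show "keys t \<subseteq> {1..ngens m d}" unfolding t(1) using keys_add[of a b] by blast
qed

lemma poly_ring_add:
  assumes "f \<in> poly_ring m d" "g \<in> poly_ring m d" shows "f + g \<in> poly_ring m d"
  unfolding poly_ring_def
proof (intro CollectI ballI)
  fix t assume "t \<in> keys (f + g)"
  hence "t \<in> keys f \<or> t \<in> keys g" using keys_add[of f g] by auto
  thus "keys t \<subseteq> {1..ngens m d}" using assms unfolding poly_ring_def by blast
qed

lemma poly_ring_zero: "0 \<in> poly_ring m d"
  by (simp add: poly_ring_def)

lemma poly_ring_const: "single 0 a \<in> poly_ring m d"
  by (simp add: poly_ring_def)

lemma free_moduleI:
  "(\<And>i. i \<in> keys v \<Longrightarrow> i \<in> J) \<Longrightarrow> (\<And>i. lookup v i \<in> poly_ring m d) \<Longrightarrow> v \<in> free_module m d J"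
  by (auto simp: free_module_def)

lemma free_moduleD:
  assumes "v \<in> free_module m d J"
  shows "i \<in> keys v \<Longrightarrow> i \<in> J" "lookup v i \<in> poly_ring m d"
  using assms by (auto simp: free_module_def)

lemma free_module_add:
  assumes "v \<in> free_module m d J" "w \<in> free_module m d J"
  shows "v + w \<in> free_module m d J"
proof (rule free_moduleI)
  fix i assume "i \<in> keys (v + w)"
  hence "i \<in> keys v \<or> i \<in> keys w" using keys_add[of v w] by auto
  thus "i \<in> J" using assms free_moduleD(1) by blast
qed (simp add: lookup_add poly_ring_add assms[THEN free_moduleD(2)])

lemma free_module_zero: "0 \<in> free_module m d J"
  by (simp add: free_module_def poly_ring_zero)

lemma free_module_sum:
  assumes "\<And>x. x \<in> A \<Longrightarrow> f x \<in> free_module m d J"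
  shows "sum f A \<in> free_module m d J"
  using assms
proof (induction A rule: infinite_finite_induct)
  case (insert x F)
  thus ?case by (simp add: free_module_add)
qed (simp_all add: free_module_zero)

lemma free_module_smult:
  assumes "f \<in> poly_ring m d" "v \<in> free_module m d J" shows "smult f v \<in> free_module m d J"
proof (rule free_moduleI)
  fix i assume "i \<in> keys (smult f v)"
  hence "i \<in> keys v" by (auto simp: in_keys_iff)
  thus "i \<in> J" by (rule free_moduleD(1)[OF assms(2)])
qed (simp add: poly_ring_mult assms free_moduleD(2)[OF assms(2)])

lemma free_module_hom_comp:
  assumes "v \<in> free_module m d J" shows "hom_comp m d s c v \<in> free_module m d J"
proof -
  have ne: "lookup (lookup v i) t \<noteq> 0" if "lookup (lookup (hom_comp m d s c v) i) t \<noteq> 0" for i t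
    using that by (auto simp: lookup_hom_comp split: if_splits)
  show ?thesis
  proof (rule free_moduleI)
    fix i assume "i \<in> keys (hom_comp m d s c v)"
    hence "lookup (hom_comp m d s c v) i \<noteq> 0" by (simp add: in_keys_iff)
    then obtain t where "lookup (lookup (hom_comp m d s c v) i) t \<noteq> 0"
      by (metis lookup_zero poly_mapping_eqI)
    hence "lookup (lookup v i) t \<noteq> 0" by (rule ne)
    hence "i \<in> keys v" by (auto simp: in_keys_iff)
    thus "i \<in> J" by (rule free_moduleD(1)[OF assms])
  next
    fix i
    have "keys (lookup (hom_comp m d s c v) i) \<subseteq> keys (lookup v i)"
      using ne by (auto simp: in_keys_iff)
    thus "lookup (hom_comp m d s c v) i \<in> poly_ring m d"
      using free_moduleD(2)[OF assms, of i] unfolding poly_ring_def by blast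
  qed
qed

lemma degrees_zlattice:
  assumes "v \<in> free_module m d J" "\<And>i. i \<in> J \<Longrightarrow> s i \<in> zlattice m"
  shows "degrees m d s v \<subseteq> zlattice m"
proof -
  have "mon_deg m d t + s i \<in> zlattice m" if "i \<in> keys v" "t \<in> keys (lookup v i)" for i t
  proof -
    have "keys t \<subseteq> {1..ngens m d}" using assms(1) that
      by (auto simp: free_module_def poly_ring_def)
    hence "mon_deg m d t \<in> zlattice m"
      by (rule semigroup_gen_zlattice[OF mon_deg_in_semigroup])
    thus ?thesis using that assms by (auto simp: free_module_def intro!: zlattice_add)
  qed
  thus ?thesis by (auto simp: degrees_def)
qed

lemma homogeneous_lin_ext:
  assumes "homogeneous m d s' c v"
    and "\<And>i. i \<in> keys v \<Longrightarrow> homogeneous m d s (s' i) (D i)"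
  shows "homogeneous m d s c (lin_ext D v)"
proof -
  have "mon_deg m d t + s j = c" if "t \<in> keys (lookup (lin_ext D v) j)" for j t
  proof -
    have "lookup (\<Sum>i\<in>keys v. lookup v i * lookup (D i) j) t \<noteq> 0"
      using that by (simp add: lookup_lin_ext in_keys_iff)
    then obtain i where i: "i \<in> keys v" "lookup (lookup v i * lookup (D i) j) t \<noteq> 0"
      unfolding lookup_sum by (meson sum.not_neutral_contains_not_neutral)
    then obtain a b where ab: "t = a + b" "a \<in> keys (lookup v i)" "b \<in> keys (lookup (D i) j)"
      using keys_mult[of "lookup v i" "lookup (D i) j"] by (auto simp: in_keys_iff)
    have "mon_deg m d b + s j = s' i" "mon_deg m d a + s' i = c"
      using assms i ab by (auto simp: homogeneous_def)
    thus ?thesis using ab by (simp add: mon_deg_add add.assoc)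
  qed
  thus ?thesis by (simp add: homogeneous_def)
qed

lemma lin_ext_sum: "lin_ext g (\<Sum>x\<in>A. f x) = (\<Sum>x\<in>A. lin_ext g (f x))"
  by (induction A rule: infinite_finite_induct) (auto simp: lin_ext_add)

lemma hom_comp_lin_ext:
  assumes v: "v \<in> free_module m d J'"
    and D: "\<And>i. i \<in> J' \<Longrightarrow> homogeneous m d s (s' i) (D i)"
  shows "hom_comp m d s c (lin_ext D v) = lin_ext D (hom_comp m d s' c v)"
proof -
  have hom: "homogeneous m d s c' (lin_ext D (hom_comp m d s' c' v))" for c'
    by (rule homogeneous_lin_ext[OF homogeneous_hom_comp])
       (rule D, rule free_moduleD(1)[OF free_module_hom_comp[OF v]])
  have "lin_ext D v = (\<Sum>c'\<in>degrees m d s' v. lin_ext D (hom_comp m d s' c' v))"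
    by (subst hom_comp_decomp[of v m d s']) (simp add: lin_ext_sum)
  hence "hom_comp m d s c (lin_ext D v)
      = (\<Sum>c'\<in>degrees m d s' v. hom_comp m d s c (lin_ext D (hom_comp m d s' c' v)))"
    by (simp add: hom_comp_sum)
  also have "\<dots> = (\<Sum>c'\<in>degrees m d s' v.
      if c = c' then lin_ext D (hom_comp m d s' c v) else 0)"
    by (intro sum.cong) (auto simp: hom_comp_homogeneous[OF hom])
  also have "\<dots> = lin_ext D (hom_comp m d s' c v)"
    by (simp add: finite_degrees hom_comp_outside)
  finally show ?thesis .
qed

lemma aug_map_sum: "aug_map m d e (\<Sum>x\<in>A. f x) = (\<Sum>x\<in>A. aug_map m d e (f x))"
proof (induction A rule: infinite_finite_induct)
  case (insert x F)
  thus ?case by (simp add: aug_map_add)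
qed (simp_all add: aug_map_def)

lemma aug_map_hom_comp:
  assumes v: "v \<in> free_module m d J" "aug_map m d e v = 0"
    and e: "\<And>i. i \<in> J \<Longrightarrow> keys (e i) \<subseteq> {s i}"
  shows "aug_map m d e (hom_comp m d s c v) = 0"
proof -
  have k: "keys (aug_map m d e (hom_comp m d s c' v)) \<subseteq> {c'}" for c'
  proof
    fix b assume b: "b \<in> keys (aug_map m d e (hom_comp m d s c' v))"
    let ?h = "\<lambda>i. coord_map m d (lookup (hom_comp m d s c' v) i)"
    have "b \<in> (\<Union>i\<in>keys (hom_comp m d s c' v). keys (?h i * e i))"
      using b keys_sum[of "\<lambda>i. ?h i * e i" "keys (hom_comp m d s c' v)"]
      unfolding aug_map_def by blast
    then obtain i where i: "i \<in> keys (hom_comp m d s c' v)" "b \<in> keys (?h i * e i)" by blast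
    then obtain x y where xy: "b = x + y" "x \<in> keys (?h i)" "y \<in> keys (e i)"
      using keys_mult[of "?h i" "e i"] by blast
    have "i \<in> J" by (rule free_moduleD(1)[OF free_module_hom_comp[OF v(1)] i(1)])
    hence y: "y = s i" using xy(3) e by blast
    obtain t where t: "t \<in> keys (lookup (hom_comp m d s c' v) i)" "x = mon_deg m d t"
      by (rule keys_coord_mapE[OF xy(2)])
    have "mon_deg m d t + s i = c'"
      using homogeneous_hom_comp[of m d s c' v] t(1) unfolding homogeneous_def by blast
    thus "b \<in> {c'}" by (simp add: xy(1) y t(2))
  qed
  have k0: "lookup (aug_map m d e (hom_comp m d s c' v)) c = 0" if "c' \<noteq> c" for c'
  proof -
    have "c \<notin> keys (aug_map m d e (hom_comp m d s c' v))" using k[of c'] that by blast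
    thus ?thesis by (simp add: in_keys_iff)
  qed
  have "0 = lookup (aug_map m d e v) c" using v by simp
  also have "aug_map m d e v = (\<Sum>c'\<in>degrees m d s v. aug_map m d e (hom_comp m d s c' v))"
    by (subst hom_comp_decomp[of v m d s]) (simp add: aug_map_sum)
  also have "lookup \<dots> c = (\<Sum>c'\<in>degrees m d s v.
      if c' = c then lookup (aug_map m d e (hom_comp m d s c v)) c else 0)"
    unfolding lookup_sum by (intro sum.cong refl) (simp add: k0)
  also have "\<dots> = lookup (aug_map m d e (hom_comp m d s c v)) c"
    by (simp add: finite_degrees hom_comp_outside aug_map_def)
  finally have "c \<notin> keys (aug_map m d e (hom_comp m d s c v))" by (simp add: in_keys_iff)
  hence "keys (aug_map m d e (hom_comp m d s c v)) = {}" using k[of c] by blast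
  thus ?thesis by simp
qed


lemma countable_poly_mapping: "countable (UNIV :: ('a::countable \<Rightarrow>\<^sub>0 'b::{countable,zero}) set)"
proof (rule countableI')
  let ?g = "\<lambda>f :: 'a \<Rightarrow>\<^sub>0 'b. (\<lambda>x. (x, lookup f x)) ` keys f"
  let ?C = "{A :: ('a \<times> 'b) set. finite A}"
  have "inj ?g"
  proof (rule injI, rule poly_mapping_eqI)
    fix f h :: "'a \<Rightarrow>\<^sub>0 'b" and x
    assume eq: "?g f = ?g h"
    have "(x, y) \<in> ?g f \<longleftrightarrow> y \<noteq> 0 \<and> y = lookup f x" for f :: "'a \<Rightarrow>\<^sub>0 'b" and y
      by (auto simp: in_keys_iff)
    hence "y \<noteq> 0 \<and> y = lookup f x \<longleftrightarrow> y \<noteq> 0 \<and> y = lookup h x" for y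
      using eq by metis
    thus "lookup f x = lookup h x" by metis
  qed
  moreover have "countable ?C" by (rule countable_Collect_finite)
  hence "inj_on (to_nat_on ?C) ?C" by (rule inj_on_to_nat_on)
  hence "inj_on (to_nat_on ?C) (range ?g)" by (rule inj_on_subset) auto
  ultimately show "inj_on (to_nat_on ?C \<circ> ?g) UNIV"
    by (rule comp_inj_on)
qed

lemma kernel_generators:
  fixes L :: "(nat \<Rightarrow>\<^sub>0 'k::field polyx) \<Rightarrow> 'w::ab_group_add"
  assumes add: "\<And>v w. L (v + w) = L v + L w"
    and smul: "\<And>f v. L v = 0 \<Longrightarrow> L (smult f v) = 0"
    and comp: "\<And>v c. v \<in> free_module m d J \<Longrightarrow> L v = 0 \<Longrightarrow> L (hom_comp m d s c v) = 0"
    and s: "\<And>i. i \<in> J \<Longrightarrow> s i \<in> zlattice m"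
  shows "\<exists>J' s' D'. (\<forall>i\<in>J'. s' i \<in> zlattice m \<and> D' i \<in> free_module m d J
      \<and> homogeneous m d s (s' i) (D' i))
      \<and> lin_ext D' ` free_module m d J' = {v \<in> free_module m d J. L v = 0}"
proof -
  let ?sc = "\<lambda>(a::'k) (v::nat \<Rightarrow>\<^sub>0 'k polyx). smult (single 0 a) v"
  interpret vs: vector_space ?sc
    by unfold_locales
       (auto simp: smult_add_right smult_add_left smult_smult mult_single single_add
         intro!: poly_mapping_eqI)
  define K where "K = {v \<in> free_module m d J. L v = 0}"
  define H where "H c = {v \<in> K. homogeneous m d s c v}" for c
  have L0: "L 0 = 0" using add[of 0 0] by simp
  have Ksum: "sum f A \<in> K" if "\<And>x. x \<in> A \<Longrightarrow> f x \<in> K" for f :: "'q \<Rightarrow> _" and A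
    using that by (induction A rule: infinite_finite_induct)
      (auto simp: K_def L0 add free_module_add free_module_zero)
  define C :: "(nat \<Rightarrow>\<^sub>0 'k polyx) set" where "C = (\<lambda>(i, t). single i (single t 1)) ` UNIV"
  have "countable (UNIV :: (nat \<times> (nat \<Rightarrow>\<^sub>0 nat)) set)"
    using countable_SIGMA[of UNIV "\<lambda>_::nat. UNIV :: (nat \<Rightarrow>\<^sub>0 nat) set"]
    by (simp add: countable_poly_mapping)
  hence cC: "countable C" unfolding C_def by (rule countable_image)
  have span: "v \<in> vs.span C" for v
  proof -
    have "v = (\<Sum>i\<in>keys v. \<Sum>t\<in>keys (lookup v i).
        ?sc (lookup (lookup v i) t) (single i (single t 1)))"
    proof -
      have "single i (lookup v i) = (\<Sum>t\<in>keys (lookup v i).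
          ?sc (lookup (lookup v i) t) (single i (single t 1)))" for i
      proof -
        have "?sc a (single i (single t 1)) = single i (single t a)" for t and a :: 'k
          by (rule poly_mapping_eqI) (simp add: lookup_single when_def mult_single)
        moreover have "single i (sum f A) = (\<Sum>t\<in>A. single i (f t))"
          for f :: "(nat \<Rightarrow>\<^sub>0 nat) \<Rightarrow> 'k polyx" and A
          by (induction A rule: infinite_finite_induct) (auto simp: single_add)
        ultimately show ?thesis
          by (subst poly_mapping_expand[of "lookup v i"]) simp
      qed
      thus ?thesis by (subst poly_mapping_expand[of v]) simp
    qed
    moreover have "\<dots> \<in> vs.span C"
      by (intro vs.span_sum vs.span_scale vs.span_base) (auto simp: C_def)
    ultimately show ?thesis by simp
  qed
  have "\<exists>B. B \<subseteq> H c \<and> countable B \<and> H c \<subseteq> vs.span B" for c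
  proof -
    obtain B where B: "B \<subseteq> H c" "vs.independent B" "H c \<subseteq> vs.span B"
      by (rule vs.basis_exists)
    have "B \<subseteq> (\<Union>T\<in>{T. T \<subseteq> C \<and> finite T}. B \<inter> vs.span T)"
    proof
      fix b assume "b \<in> B"
      have "b \<in> vs.span C" by (rule span)
      then obtain T r where T: "finite T" "T \<subseteq> C" "b = (\<Sum>a\<in>T. ?sc (r a) a)"
        unfolding vs.span_explicit by blast
      have "b \<in> vs.span T"
        unfolding T(3) by (intro vs.span_sum vs.span_scale vs.span_base)
      with T show "b \<in> (\<Union>T\<in>{T. T \<subseteq> C \<and> finite T}. B \<inter> vs.span T)" using \<open>b \<in> B\<close> by blast
    qed
    moreover have "countable (\<Union>T\<in>{T. T \<subseteq> C \<and> finite T}. B \<inter> vs.span T)"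
    proof (rule countable_UN)
      have "{T. T \<subseteq> C \<and> finite T} = {T. finite T \<and> T \<subseteq> C}" by blast
      thus "countable {T. T \<subseteq> C \<and> finite T}"
        using countable_Collect_finite_subset[OF cC] by simp
      fix T assume "T \<in> {T. T \<subseteq> C \<and> finite T}"
      hence "finite T" by simp
      moreover have "vs.independent (B \<inter> vs.span T)"
        by (rule vs.independent_mono[OF B(2)]) simp
      ultimately have "finite (B \<inter> vs.span T)"
        using vs.independent_span_bound[of T "B \<inter> vs.span T"] by simp
      thus "countable (B \<inter> vs.span T)" by (rule countable_finite)
    qed
    ultimately have "countable B" by (rule countable_subset)
    thus ?thesis using B by blast
  qed
  then obtain B where B: "\<And>c. B c \<subseteq> H c" "\<And>c. countable (B c)" "\<And>c. H c \<subseteq> vs.span (B c)"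
    by metis
  define U where "U = (SIGMA c : zlattice m. B c)"
  have cU: "countable U" unfolding U_def
    by (intro countable_SIGMA B) (rule countable_subset[OF subset_UNIV countable_poly_mapping])
  define J' where "J' = to_nat_on U ` U"
  define s' where "s' = fst \<circ> from_nat_into U"
  define D' where "D' = snd \<circ> from_nat_into U"
  have J': "(s' i, D' i) \<in> U" if "i \<in> J'" for i
    using that cU by (auto simp: J'_def s'_def D'_def)
  have J'K: "s' i \<in> zlattice m" "D' i \<in> K" "homogeneous m d s (s' i) (D' i)" if "i \<in> J'" for i
    using J'[OF that] B(1) by (auto simp: U_def H_def)
  let ?W = "lin_ext D' ` free_module m d J'"
  have "?W \<subseteq> K"
  proof
    fix w assume "w \<in> ?W"
    then obtain v where v: "v \<in> free_module m d J'" "w = lin_ext D' v" by blast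
    have "smult (lookup v i) (D' i) \<in> K" if "i \<in> keys v" for i
      using that v J'K(2)[of i] smul by (auto simp: K_def free_module_def[of m d J']
          intro!: free_module_smult)
    thus "w \<in> K" unfolding v lin_ext_def by (intro Ksum)
  qed
  moreover have "K \<subseteq> ?W"
  proof -
    have sub: "vs.subspace ?W"
      unfolding vs.subspace_def
    proof (intro conjI ballI allI)
      show "0 \<in> ?W" by (rule image_eqI[of _ _ 0]) (auto simp: free_module_zero)
    next
      fix x y assume "x \<in> ?W" "y \<in> ?W"
      thus "x + y \<in> ?W" by (auto simp flip: lin_ext_add intro!: imageI free_module_add)
    next
      fix a x assume "x \<in> ?W"
      thus "?sc a x \<in> ?W"
        by (auto simp flip: lin_ext_smult intro!: imageI free_module_smult poly_ring_const)
    qed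
    have HW: "H c \<subseteq> ?W" if c: "c \<in> zlattice m" for c
    proof -
      have "B c \<subseteq> ?W"
      proof
        fix b assume "b \<in> B c"
        hence u: "(c, b) \<in> U" using c by (simp add: U_def)
        let ?i = "to_nat_on U (c, b)"
        have "D' ?i = b" "?i \<in> J'" using u cU by (auto simp: D'_def J'_def)
        hence "lin_ext D' (single ?i 1) = b"
          by (intro poly_mapping_eqI) (simp add: lin_ext_single)
        moreover have "single ?i 1 \<in> free_module m d J'"
          using \<open>?i \<in> J'\<close> poly_ring_const[of 1 m d] poly_ring_zero[of m d]
          by (auto simp: free_module_def lookup_single when_def)
        ultimately show "b \<in> ?W" by (metis imageI)
      qed
      hence "vs.span (B c) \<subseteq> ?W" using sub by (rule vs.span_minimal)
      thus ?thesis using B(3) by blast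
    qed
    show ?thesis
    proof
      fix v assume v: "v \<in> K"
      have "hom_comp m d s c v \<in> ?W" if "c \<in> degrees m d s v" for c
      proof -
        have "v \<in> free_module m d J" using v by (simp add: K_def)
        hence "degrees m d s v \<subseteq> zlattice m" by (rule degrees_zlattice) (rule s)
        hence "c \<in> zlattice m" using that by blast
        moreover have "hom_comp m d s c v \<in> H c"
          using v comp by (auto simp: H_def K_def free_module_hom_comp homogeneous_hom_comp)
        ultimately show ?thesis using HW by blast
      qed
      hence "(\<Sum>c\<in>degrees m d s v. hom_comp m d s c v) \<in> ?W"
        by (intro vs.subspace_sum[OF sub])
      thus "v \<in> ?W" by (simp flip: hom_comp_decomp)
    qed
  qed
  ultimately have "?W = K" by blast
  thus ?thesis using J'K by (intro exI[of _ J'] exI[of _ s'] exI[of _ D']) (auto simp: K_def)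
qed

lemma ex_free_resolution: "\<exists>F :: 'k::field free_complex. free_resolution m d F"
proof -
  let ?e = "\<lambda>_::nat. 1 :: 'k semiring_elem"
  let ?J = "{0::nat}" and ?s = "\<lambda>_::nat. 0 :: zvec"
  define good :: "nat set \<times> (nat \<Rightarrow> zvec) \<times> nat set \<times> (nat \<Rightarrow> zvec) \<times> (nat \<Rightarrow> nat \<Rightarrow>\<^sub>0 'k polyx) \<Rightarrow> bool"
    where "good = (\<lambda>(J, s, J', s', D). \<forall>i\<in>J'. s' i \<in> zlattice m \<and> D i \<in> free_module m d J
      \<and> homogeneous m d s (s' i) (D i))"
  define P where "P n x \<longleftrightarrow> good x \<and> (n = (0::nat) \<longrightarrow> (case x of (J, s, J', s', D) \<Rightarrow>
      J = ?J \<and> s = ?s \<and> lin_ext D ` free_module m d J'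
        = {v \<in> free_module m d ?J. aug_map m d ?e v = 0}))" for n x
  define Q where "Q n x y \<longleftrightarrow> (case (x, y) of ((J, s, J', s', D), (J1, s1, J1', s1', D1)) \<Rightarrow>
      J1 = J' \<and> s1 = s' \<and> lin_ext D1 ` free_module m d J1'
        = {v \<in> free_module m d J'. lin_ext D v = 0})" for n :: nat and x y ::
      "nat set \<times> (nat \<Rightarrow> zvec) \<times> nat set \<times> (nat \<Rightarrow> zvec) \<times> (nat \<Rightarrow> nat \<Rightarrow>\<^sub>0 'k polyx)"
  have z: "0 \<in> zlattice m" by (simp add: zlattice_def)
  have "\<exists>J' s' D'. (\<forall>i\<in>J'. s' i \<in> zlattice m \<and> D' i \<in> free_module m d ?J
      \<and> homogeneous m d ?s (s' i) (D' i))
      \<and> lin_ext D' ` free_module m d J' = {v \<in> free_module m d ?J. aug_map m d ?e v = 0}"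
    by (rule kernel_generators)
       (auto simp: aug_map_add aug_map_smult z intro: aug_map_hom_comp[where J = ?J])
  then obtain J' s' D' where "P 0 (?J, ?s, J', s', D')"
    unfolding P_def good_def by auto
  moreover have "\<exists>y. P (Suc n) y \<and> Q n x y" if "P n x" for n x
  proof -
    obtain J s J' s' D where x: "x = (J, s, J', s', D)" by (cases x) auto
    have g: "\<forall>i\<in>J'. s' i \<in> zlattice m \<and> D i \<in> free_module m d J \<and> homogeneous m d s (s' i) (D i)"
      using that by (simp add: P_def good_def x)
    have "\<exists>J1' s1' D1'. (\<forall>i\<in>J1'. s1' i \<in> zlattice m \<and> D1' i \<in> free_module m d J'
        \<and> homogeneous m d s' (s1' i) (D1' i))
        \<and> lin_ext D1' ` free_module m d J1' = {v \<in> free_module m d J'. lin_ext D v = 0}"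
    proof (rule kernel_generators)
      fix v c assume v: "v \<in> free_module m d J'" "lin_ext D v = 0"
      have "hom_comp m d s c (lin_ext D v) = lin_ext D (hom_comp m d s' c v)"
        by (rule hom_comp_lin_ext[OF v(1)]) (use g in auto)
      thus "lin_ext D (hom_comp m d s' c v) = 0" using v by simp
    next
      fix f v assume "lin_ext D v = 0"
      thus "lin_ext D (smult f v) = 0"
        by (intro poly_mapping_eqI) (simp add: lin_ext_smult)
    qed (use g in \<open>auto simp: lin_ext_add\<close>)
    then obtain J1' s1' D1' where "P (Suc n) (J', s', J1', s1', D1')"
        "Q n x (J', s', J1', s1', D1')"
      unfolding P_def Q_def good_def x by auto
    thus ?thesis by blast
  qed
  ultimately obtain f where f: "\<And>n. P n (f n)" "\<And>n. Q n (f n) (f (Suc n))"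
    using dependent_nat_choice[of P Q] by metis
  define J where "J n = fst (f n)" for n
  define s where "s n = fst (snd (f n))" for n
  define J1 where "J1 n = fst (snd (snd (f n)))" for n
  define s1 where "s1 n = fst (snd (snd (snd (f n))))" for n
  define D where "D n = snd (snd (snd (snd (f n))))" for n
  have fn: "f n = (J n, s n, J1 n, s1 n, D n)" for n
    by (simp add: J_def s_def J1_def s1_def D_def)
  have q: "J1 n = J (Suc n)" "s1 n = s (Suc n)"
      "lin_ext (D (Suc n)) ` free_module m d (J (Suc (Suc n)))
        = {v \<in> free_module m d (J (Suc n)). lin_ext (D n) v = 0}" for n
    using f(2)[of n] f(2)[of "Suc n"] unfolding Q_def fn by auto
  have p: "s (Suc n) i \<in> zlattice m" "D n i \<in> free_module m d (J n)"
      "homogeneous m d (s n) (s (Suc n) i) (D n i)" if "i \<in> J (Suc n)" for n i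
    using f(1)[of n] that q(1,2)[of n] unfolding P_def good_def fn by auto
  have p0: "J 0 = ?J" "s 0 = ?s" "lin_ext (D 0) ` free_module m d (J 1)
        = {v \<in> free_module m d ?J. aug_map m d ?e v = 0}"
    using f(1)[of 0] q(1)[of 0] unfolding P_def fn by auto
  have surj: "aug_map m d ?e ` free_module m d ?J = (semigroup_ring m d :: 'k semiring_elem set)"
  proof
    show "aug_map m d ?e ` free_module m d ?J \<subseteq> (semigroup_ring m d :: 'k semiring_elem set)"
    proof clarify
      fix v :: "nat \<Rightarrow>\<^sub>0 'k polyx" assume v: "v \<in> free_module m d ?J"
      have "aug_map m d ?e v = coord_map m d (lookup v 0)"
        using v by (subst aug_map_superset[of "{0}"]) (auto simp: free_module_def)
      moreover have "keys (coord_map m d (lookup v 0)) \<subseteq> semigroup_gen m d"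
      proof
        fix b assume "b \<in> keys (coord_map m d (lookup v 0))"
        then obtain t where "t \<in> keys (lookup v 0)" "b = mon_deg m d t"
          by (rule keys_coord_mapE)
        moreover from this have "keys t \<subseteq> {1..ngens m d}"
          using free_moduleD(2)[OF v, of 0] unfolding poly_ring_def by blast
        ultimately show "b \<in> semigroup_gen m d" by (simp add: mon_deg_in_semigroup)
      qed
      ultimately show "aug_map m d ?e v \<in> semigroup_ring m d" by (simp add: semigroup_ring_def)
    qed
    show "(semigroup_ring m d :: 'k semiring_elem set) \<subseteq> aug_map m d ?e ` free_module m d ?J"
    proof
      fix g :: "'k semiring_elem" assume g: "g \<in> semigroup_ring m d"
      have "\<forall>b\<in>keys g. \<exists>t. keys t \<subseteq> {1..ngens m d} \<and> mon_deg m d t = b"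
      proof (rule ballI, rule semigroup_gen_mon_deg)
        fix b assume "b \<in> keys g"
        thus "b \<in> semigroup_gen m d" using g unfolding semigroup_ring_def by blast
      qed
      then obtain t where t: "\<And>b. b \<in> keys g \<Longrightarrow> keys (t b) \<subseteq> {1..ngens m d}"
          "\<And>b. b \<in> keys g \<Longrightarrow> mon_deg m d (t b) = b" by metis
      define h where "h = (\<Sum>b\<in>keys g. single (t b) (lookup g b))"
      have "coord_map m d h = (\<Sum>b\<in>keys g. single b (lookup g b))"
        unfolding h_def coord_map_sum by (intro sum.cong) (auto simp: t)
      hence gh: "coord_map m d h = g" by (simp flip: poly_mapping_expand)
      have "h \<in> poly_ring m d"
        unfolding poly_ring_def
      proof (intro CollectI ballI)
        fix u assume "u \<in> keys h"
        then obtain b where "b \<in> keys g" "u \<in> keys (single (t b) (lookup g b))"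
          unfolding h_def using keys_sum[of "\<lambda>b. single (t b) (lookup g b)" "keys g"] by blast
        hence "b \<in> keys g" "u = t b" by (simp_all split: if_splits)
        thus "keys u \<subseteq> {1..ngens m d}" using t(1) by simp
      qed
      hence "single 0 h \<in> free_module m d ?J"
        using poly_ring_zero by (auto simp: free_module_def lookup_single when_def)
      moreover have "aug_map m d ?e (single 0 h) = g"
        by (subst aug_map_superset[of "{0}"]) (auto simp: gh)
      ultimately show "g \<in> aug_map m d ?e ` free_module m d ?J" by (metis imageI)
    qed
  qed
  let ?F = "\<lparr>basis = J, shift = s, diff = D, aug = ?e\<rparr>"
  have sz: "\<forall>i\<in>J n. s n i \<in> zlattice m" for n
  proof (cases n)
    case 0
    thus ?thesis using p0(2) z by simp
  next
    case (Suc k)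
    thus ?thesis using p(1) by simp
  qed
  have a: "\<forall>i\<in>J 0. ?e i \<in> semigroup_ring m d \<and> keys (?e i) \<subseteq> {s 0 i}"
    by (simp add: p0(2) semigroup_ring_def semigroup_gen.zero)
  have dd: "\<forall>i\<in>J (Suc n). D n i \<in> free_module m d (J n)
      \<and> homogeneous m d (s n) (s (Suc n) i) (D n i)" for n
    using p(2,3) by blast
  have "free_resolution m d ?F"
    unfolding free_resolution_def free_complex.simps
  proof (intro conjI)
    show "\<forall>n. \<forall>i\<in>J n. s n i \<in> zlattice m" by (rule allI, rule sz)
    show "\<forall>i\<in>J 0. ?e i \<in> semigroup_ring m d \<and> keys (?e i) \<subseteq> {s 0 i}" by (rule a)
    show "\<forall>n. \<forall>i\<in>J (Suc n). D n i \<in> free_module m d (J n)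
      \<and> homogeneous m d (s n) (s (Suc n) i) (D n i)" by (rule allI, rule dd)
    show "aug_map m d ?e ` free_module m d (J 0) = semigroup_ring m d"
      unfolding p0(1) by (rule surj)
    show "lin_ext (D 0) ` free_module m d (J 1)
        = {v \<in> free_module m d (J 0). aug_map m d ?e v = 0}"
      unfolding p0(1) by (rule p0(3))
    show "\<forall>n. lin_ext (D (Suc n)) ` free_module m d (J (Suc (Suc n)))
        = {v \<in> free_module m d (J (Suc n)). lin_ext (D n) v = 0}"
      by (rule allI, rule q(3))
  qed
  thus ?thesis by (rule exI)
qed

end

theory Submission
  imports Defs
begin

text \<open>
  The vanishing is read off from an arbitrary multigraded free resolution \<open>F\<close> of the semigroup ring
  \<open>R\<close> by killing the variables one at a time, starting with \<open>x\<^sub>1\<close>. As \<open>x\<^sub>1\<close> is regular on \<open>R\<close>,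
  \<open>F / x\<^sub>1 F\<close> resolves \<open>R / x\<^sub>1 R\<close>, and the long exact sequences for the other variables show that
  \<open>F \<otimes> k\<close> is exact in degree \<open>b\<close> as soon as \<open>R / x\<^sub>1 R\<close> vanishes in degree \<open>b - a\<^sup>I\<close> for every
  \<open>I \<subseteq> {2, \<dots>, n}\<close>. This means that the squarefree divisor complex of \<open>b\<close> is a cone with apex \<open>1\<close>,
  which is what the bound on \<open>b\<^sub>0\<close> ensures.
\<close>


subsection \<open>Monomial submodules\<close>

definition var :: "nat \<Rightarrow> 'k::field polyx" where
  "var u = single (single u (Suc 0)) 1"

text \<open>The submodule \<open>V F\<close> generated by the multiples of the variables in
  \<open>V\<close>. The ideal is monomial, so membership is tested on each occurring monomial; the
  ambient free module is imposed separately.\<close>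

definition var_submodule :: "nat set \<Rightarrow> (nat \<Rightarrow>\<^sub>0 'k::field polyx) set" where
  "var_submodule V = {v. \<forall>i t. lookup (lookup v i) t \<noteq> 0 \<longrightarrow> keys t \<inter> V \<noteq> {}}"

text \<open>The quotient in the division by \<open>x\<^sub>u\<close>: the coefficient of
  \<open>t\<close> is that of \<open>x\<^sub>u t\<close> in \<open>v\<close>, and terms not
  divisible by \<open>x\<^sub>u\<close> are dropped.\<close>

definition div_var :: "nat \<Rightarrow> (nat \<Rightarrow>\<^sub>0 'k::field polyx) \<Rightarrow> (nat \<Rightarrow>\<^sub>0 'k polyx)" where
  "div_var u v = Poly_Mapping.map (Poly_Mapping.map_key (\<lambda>t. single u (Suc 0) + t)) v"

lemma lookup_single_times:
  fixes f :: "'k::field polyx"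
  shows "lookup (single t 1 * f) (t + s) = lookup f s"
proof -
  have "single t 1 * f = (\<Sum>r\<in>keys f. single (t + r) (lookup f r))"
    by (subst poly_mapping_expand[of f]) (simp add: sum_distrib_left mult_single)
  thus ?thesis by (auto simp: lookup_sum lookup_single when_def in_keys_iff)
qed

lemma keys_single_times:
  fixes f :: "'k::field polyx"
  assumes "lookup (single t 1 * f) s \<noteq> 0"
  shows "\<exists>r. s = t + r \<and> lookup f r \<noteq> 0"
proof -
  have "s \<in> keys (single t 1 * f)" using assms by (simp add: in_keys_iff)
  then obtain a b where "s = a + b" "a \<in> keys (single t (1::'k))" "b \<in> keys f"
    using keys_mult[of "single t 1" f] by blast
  thus ?thesis by (auto simp: in_keys_iff split: if_splits)
qed

lemma lookup_div_var:
  "lookup (lookup (div_var u v) i) t = lookup (lookup v i) (single u (Suc 0) + t)"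
proof -
  have "inj ((+) (single u (Suc 0)))" by (simp add: inj_on_def)
  thus ?thesis
    by (simp add: div_var_def Poly_Mapping.map.rep_eq map_key.rep_eq when_def)
qed

lemma single_one_add_cancel:
  fixes t :: "nat \<Rightarrow>\<^sub>0 nat"
  assumes "u \<in> keys t" shows "single u (Suc 0) + (t - single u (Suc 0)) = t"
  using assms by (intro poly_mapping_eqI) (auto simp: lookup_add lookup_minus lookup_single when_def in_keys_iff)

lemma keys_single_one_add:
  fixes t :: "nat \<Rightarrow>\<^sub>0 nat"
  shows "keys (single u (Suc 0) + t) = insert u (keys t)"
  by (auto simp: in_keys_iff lookup_add lookup_single when_def split: if_splits)

text \<open>Division with remainder: subtracting the multiple of \<open>x\<^sub>u\<close> removes
  exactly the terms divisible by \<open>x\<^sub>u\<close>.\<close>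

lemma lookup_minus_var_div_var:
  "lookup (lookup (v - smult (var u) (div_var u v)) i) t = (if u \<in> keys t then 0 else lookup (lookup v i) t)"
proof (cases "u \<in> keys t")
  case True
  have "lookup (var u * lookup (div_var u v) i) (single u (Suc 0) + (t - single u (Suc 0)))
      = lookup (lookup (div_var u v) i) (t - single u (Suc 0))"
    unfolding var_def by (rule lookup_single_times)
  thus ?thesis using True by (simp add: lookup_minus lookup_div_var single_one_add_cancel)
next
  case False
  have "lookup (var u * lookup (div_var u v) i) t = 0"
  proof (rule ccontr)
    assume "lookup (var u * lookup (div_var u v) i) t \<noteq> 0"
    then obtain r where "t = single u (Suc 0) + r"
      unfolding var_def using keys_single_times by blast
    thus False using False by (simp add: keys_single_one_add)
  qed
  thus ?thesis using False by (simp add: lookup_minus)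
qed

lemma minus_var_div_var_in_var_submodule:
  assumes "v \<in> var_submodule (insert u V)"
  shows "v - smult (var u) (div_var u v) \<in> var_submodule V"
proof -
  have "keys t \<inter> V \<noteq> {}" if "u \<notin> keys t" "lookup (lookup v i) t \<noteq> 0" for i t
    using assms that unfolding var_submodule_def by blast
  thus ?thesis unfolding var_submodule_def mem_Collect_eq lookup_minus_var_div_var by simp
qed

section \<open>Closure properties of monomial submodules\<close>

lemma var_submodule_empty: "var_submodule {} = {0}"
  by (auto simp: var_submodule_def intro!: poly_mapping_eqI2)

lemma var_submodule_mono: "V \<subseteq> W \<Longrightarrow> var_submodule V \<subseteq> var_submodule W"
  unfolding var_submodule_def by blast

lemma var_submodule_zero: "0 \<in> var_submodule V"
  by (simp add: var_submodule_def)

lemma var_submodule_add: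
  assumes "v \<in> var_submodule V" "w \<in> var_submodule V"
  shows "v + w \<in> var_submodule V"
proof -
  have "lookup (lookup v i) t \<noteq> 0 \<or> lookup (lookup w i) t \<noteq> 0"
    if "lookup (lookup (v + w) i) t \<noteq> 0" for i t
    using that by (auto simp: lookup_add)
  thus ?thesis using assms unfolding var_submodule_def by blast
qed

lemma var_submodule_minus:
  assumes "v \<in> var_submodule V" "w \<in> var_submodule V"
  shows "v - w \<in> var_submodule V"
proof -
  have "lookup (lookup v i) t \<noteq> 0 \<or> lookup (lookup w i) t \<noteq> 0"
    if "lookup (lookup (v - w) i) t \<noteq> 0" for i t
    using that by (auto simp: lookup_minus)
  thus ?thesis using assms unfolding var_submodule_def by blast
qed

lemma var_times_in_var_submodule: "u \<in> V \<Longrightarrow> smult (var u) v \<in> var_submodule V"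
  unfolding var_submodule_def var_def
  by (auto dest!: keys_single_times simp: keys_single_one_add)

text \<open>For \<open>u \<notin> V\<close>, \<open>x\<^sub>u\<close> is regular modulo
  \<open>V\<close>: a variable of \<open>V\<close> dividing \<open>x\<^sub>u t\<close> already
  divides \<open>t\<close>.\<close>

lemma var_submodule_cancel_var:
  assumes "smult (var u) v \<in> var_submodule V" "u \<notin> V"
  shows "v \<in> var_submodule V"
  unfolding var_submodule_def
proof (intro CollectI allI impI)
  fix i t assume "lookup (lookup v i) t \<noteq> 0"
  hence "lookup (lookup (smult (var u) v) i) (single u (Suc 0) + t) \<noteq> 0"
    by (simp add: var_def lookup_single_times)
  hence "keys (single u (Suc 0) + t) \<inter> V \<noteq> {}"
    using assms(1) unfolding var_submodule_def by blast
  thus "keys t \<inter> V \<noteq> {}" using assms(2) by (simp add: keys_single_one_add)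
qed

text \<open>By linearity, differentials descend to the quotients by variables.\<close>

lemma lin_ext_in_var_submodule:
  assumes "v \<in> var_submodule V" shows "lin_ext g v \<in> var_submodule V"
  unfolding var_submodule_def
proof (intro CollectI allI impI)
  fix j t assume "lookup (lookup (lin_ext g v) j) t \<noteq> 0"
  hence "lookup (\<Sum>i\<in>keys v. lookup v i * lookup (g i) j) t \<noteq> 0"
    by (simp add: lookup_lin_ext)
  then obtain i where i: "lookup (lookup v i * lookup (g i) j) t \<noteq> 0"
    unfolding lookup_sum by (meson sum.not_neutral_contains_not_neutral)
  then obtain r s where rs: "t = r + s" "r \<in> keys (lookup v i)"
    using keys_mult[of "lookup v i" "lookup (g i) j"] by (auto simp: in_keys_iff)
  have "keys r \<inter> V \<noteq> {}" using assms rs(2) unfolding var_submodule_def in_keys_iff by blast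
  moreover have "keys r \<subseteq> keys t" by (auto simp: rs(1) in_keys_iff lookup_add)
  ultimately show "keys t \<inter> V \<noteq> {}" by blast
qed

lemma var_submodule_smult:
  assumes "v \<in> var_submodule V" shows "smult f v \<in> var_submodule V"
  unfolding var_submodule_def
proof (intro CollectI allI impI)
  fix i t assume "lookup (lookup (smult f v) i) t \<noteq> 0"
  then obtain r s where rs: "t = r + s" "s \<in> keys (lookup v i)"
    using keys_mult[of f "lookup v i"] by (auto simp: in_keys_iff)
  have "keys s \<inter> V \<noteq> {}" using assms rs(2) unfolding var_submodule_def in_keys_iff by blast
  moreover have "keys s \<subseteq> keys t" by (auto simp: rs(1) in_keys_iff lookup_add)
  ultimately show "keys t \<inter> V \<noteq> {}" by blast
qed

lemma hom_comp_in_var_submodule: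
  "v \<in> var_submodule V \<Longrightarrow> hom_comp m d s c v \<in> var_submodule V"
  by (auto simp: var_submodule_def lookup_hom_comp)

section \<open>Differences and constant terms\<close>

lemma lin_ext_minus:
  fixes v w :: "nat \<Rightarrow>\<^sub>0 'k::field polyx"
  shows "lin_ext g (v - w) = lin_ext g v - lin_ext g w"
  using lin_ext_add[of g "v - w" w] by simp

lemma aug_map_minus:
  "aug_map m d e (v - w) = aug_map m d e v - aug_map m d e w"
  using aug_map_add[of m d e "v - w" w] by simp

lemma diff_eq_add_smult:
  "v - w = v + smult (single 0 (-1)) (w :: nat \<Rightarrow>\<^sub>0 'k::field polyx)"
proof -
  have "smult (single 0 (-1)) w = - w"
    by (rule poly_mapping_eqI) (simp add: single_uminus single_one)
  thus ?thesis by simp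
qed

lemma free_module_minus:
  "v \<in> free_module m d J \<Longrightarrow> w \<in> free_module m d J \<Longrightarrow> v - w \<in> free_module m d J"
  unfolding diff_eq_add_smult
  by (intro free_module_add free_module_smult poly_ring_const)

text \<open>Exponents are natural numbers, so a product of monomials is 1 only if both factors
  are.\<close>

lemma lookup_mult_zero:
  fixes f g :: "'k::field polyx"
  shows "lookup (f * g) 0 = lookup f 0 * lookup g 0"
proof -
  have z: "t + u = 0 \<longleftrightarrow> t = 0 \<and> u = 0" for t u :: "nat \<Rightarrow>\<^sub>0 nat"
  proof
    assume "t + u = 0"
    hence "lookup t i + lookup u i = 0" for i by (metis lookup_add lookup_zero)
    thus "t = 0 \<and> u = 0" by (auto intro!: poly_mapping_eqI)
  qed simp
  have "f * g = (\<Sum>t\<in>keys f. \<Sum>u\<in>keys g. single (t + u) (lookup f t * lookup g u))"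
    by (subst poly_mapping_expand[of f], subst poly_mapping_expand[of g])
       (simp add: sum_product mult_single)
  hence "lookup (f * g) 0 = (\<Sum>t\<in>keys f. \<Sum>u\<in>keys g.
      (if t = 0 then lookup f t else 0) * (if u = 0 then lookup g u else 0))"
    by (simp only: lookup_sum lookup_single when_def z) (intro sum.cong refl, simp)
  also have "\<dots> = (\<Sum>t\<in>keys f. if t = 0 then lookup f t else 0)
      * (\<Sum>u\<in>keys g. if u = 0 then lookup g u else 0)"
    by (rule sum_product[symmetric])
  also have "\<dots> = lookup f 0 * lookup g 0"
    by (simp add: in_keys_iff)
  finally show ?thesis .
qed

text \<open>Connects killing all variables with taking constant terms: a nonconstant monomial of the
  polynomial ring contains some \<open>x\<^sub>u\<close>.\<close>

lemma var_submoduleI: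
  assumes "v \<in> free_module m d J" "\<And>i. lookup (lookup v i) 0 = 0"
  shows "v \<in> var_submodule {1..ngens m d}"
  unfolding var_submodule_def
proof (intro CollectI allI impI)
  fix i t assume t: "lookup (lookup v i) t \<noteq> 0"
  hence "t \<noteq> 0" using assms(2) by auto
  moreover have "keys t \<subseteq> {1..ngens m d}"
    using free_moduleD(2)[OF assms(1), of i] t by (simp add: poly_ring_def in_keys_iff)
  ultimately show "keys t \<inter> {1..ngens m d} \<noteq> {}" by (simp add: Int_absorb2)
qed

section \<open>Multidegrees under multiplication and division by a variable\<close>

lemma mon_deg_single: "mon_deg m d (single u (Suc 0)) = gen m d u"
  by (rule poly_mapping_eqI) (simp add: mon_deg_superset[of "{u}"])

lemma var_in_poly_ring: "u \<in> {1..ngens m d} \<Longrightarrow> var u \<in> poly_ring m d"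
  by (simp add: var_def poly_ring_def)

lemma div_var_in_free_module:
  assumes "v \<in> free_module m d J" shows "div_var u v \<in> free_module m d J"
proof (rule free_moduleI)
  fix i assume "i \<in> keys (div_var u v)"
  hence "lookup (div_var u v) i \<noteq> 0" by (simp add: in_keys_iff)
  then obtain t where "lookup (lookup (div_var u v) i) t \<noteq> 0"
    by (metis lookup_zero poly_mapping_eqI)
  hence "i \<in> keys v" by (auto simp: lookup_div_var in_keys_iff)
  thus "i \<in> J" by (rule free_moduleD(1)[OF assms])
next
  fix i
  have "keys t \<subseteq> {1..ngens m d}" if "t \<in> keys (lookup (div_var u v) i)" for t
  proof -
    have "single u (Suc 0) + t \<in> keys (lookup v i)" using that by (simp add: in_keys_iff lookup_div_var)
    hence "keys (single u (Suc 0) + t) \<subseteq> {1..ngens m d}"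
      using free_moduleD(2)[OF assms, of i] unfolding poly_ring_def by blast
    thus ?thesis unfolding keys_single_one_add by blast
  qed
  thus "lookup (div_var u v) i \<in> poly_ring m d" by (auto simp: poly_ring_def)
qed

lemma homogeneous_div_var:
  assumes "homogeneous m d s c v" shows "homogeneous m d s (c - gen m d u) (div_var u v)"
  unfolding homogeneous_iff
proof (intro allI impI)
  fix i t assume "lookup (lookup (div_var u v) i) t \<noteq> 0"
  hence "mon_deg m d (single u (Suc 0) + t) + s i = c"
    using assms unfolding homogeneous_iff lookup_div_var by blast
  thus "mon_deg m d t + s i = c - gen m d u" by (auto simp: mon_deg_add mon_deg_single algebra_simps)
qed

lemma homogeneous_var_times:
  assumes "homogeneous m d s (c - gen m d u) v" shows "homogeneous m d s c (smult (var u) v)"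
  unfolding homogeneous_iff
proof (intro allI impI)
  fix i t assume "lookup (lookup (smult (var u) v) i) t \<noteq> 0"
  then obtain r where r: "t = single u (Suc 0) + r" "lookup (lookup v i) r \<noteq> 0"
    by (auto simp: var_def dest!: keys_single_times)
  hence "mon_deg m d r + s i = c - gen m d u" using assms unfolding homogeneous_iff by blast
  thus "mon_deg m d t + s i = c" by (simp add: r(1) mon_deg_add mon_deg_single algebra_simps)
qed

lemma homogeneous_minus:
  assumes "homogeneous m d s c v" "homogeneous m d s c w"
  shows "homogeneous m d s c (v - w)"
  unfolding homogeneous_iff
proof (intro allI impI)
  fix i t assume "lookup (lookup (v - w) i) t \<noteq> 0"
  hence "lookup (lookup v i) t \<noteq> 0 \<or> lookup (lookup w i) t \<noteq> 0" by (auto simp: lookup_minus)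
  thus "mon_deg m d t + s i = c" using assms unfolding homogeneous_iff by blast
qed

lemma hom_comp_minus: "hom_comp m d s c (v - w) = hom_comp m d s c v - hom_comp m d s c w"
  using hom_comp_add[of m d s c "v - w" w] by simp

lemma aug_map_homogeneous:
  assumes v: "v \<in> free_module m d J" "homogeneous m d s c v"
    and e: "\<And>i. i \<in> J \<Longrightarrow> keys (e i) \<subseteq> {s i}"
  shows "keys (aug_map m d e v) \<subseteq> {c}"
proof
  fix b assume b: "b \<in> keys (aug_map m d e v)"
  let ?h = "\<lambda>i. coord_map m d (lookup v i)"
  obtain i where i: "i \<in> keys v" "b \<in> keys (?h i * e i)"
    using b keys_sum[of "\<lambda>i. ?h i * e i" "keys v"] unfolding aug_map_def by blast
  obtain x y where xy: "b = x + y" "x \<in> keys (?h i)" "y \<in> keys (e i)"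
    using i(2) keys_mult[of "?h i" "e i"] by blast
  have "y = s i" using xy(3) e free_moduleD(1)[OF v(1) i(1)] by blast
  moreover obtain t where "t \<in> keys (lookup v i)" "x = mon_deg m d t"
    by (rule keys_coord_mapE[OF xy(2)])
  ultimately show "b \<in> {c}" using v(2) by (auto simp: homogeneous_def xy(1))
qed


subsection \<open>Quotients of a resolution by variables\<close>

locale resolution =
  fixes m d :: nat and F :: "'k::field free_complex"
  assumes res: "free_resolution m d F"
begin

abbreviation "FM p \<equiv> free_module m d (basis F p)"
abbreviation "hom p \<equiv> homogeneous m d (shift F p)"
abbreviation "au \<equiv> aug_map m d (aug F)"

text \<open>Extending the differential by zero in degree 0 makes every element there a cycle, so one
  homology condition serves all \<open>p\<close>; the augmentation stays outside the
  complex.\<close>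

definition bd :: "nat \<Rightarrow> (nat \<Rightarrow>\<^sub>0 'k polyx) \<Rightarrow> (nat \<Rightarrow>\<^sub>0 'k polyx)" where
  "bd p v = (case p of 0 \<Rightarrow> 0 | Suc q \<Rightarrow> lin_ext (diff F q) v)"

lemma bd_simps [simp]: "bd 0 v = 0" "bd (Suc q) v = lin_ext (diff F q) v"
  by (simp_all add: bd_def)

lemma bd_minus: "bd p (v - w) = bd p v - bd p w"
  by (cases p) (simp_all add: lin_ext_minus)

lemma bd_smult: "bd p (smult r v) = smult r (bd p v)"
  by (cases p) (simp_all add: lin_ext_smult poly_mapping_eqI)

lemma bd_in_var_submodule: "v \<in> var_submodule V \<Longrightarrow> bd p v \<in> var_submodule V"
  by (cases p) (simp_all add: var_submodule_zero lin_ext_in_var_submodule)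

section \<open>Exactness of the resolution in terms of \<open>bd\<close>\<close>

lemma shift_aug: "i \<in> basis F 0 \<Longrightarrow> keys (aug F i) \<subseteq> {shift F 0 i}"
  using res by (simp add: free_resolution_def)

lemma diff_homogeneous: "i \<in> basis F (Suc q) \<Longrightarrow> hom q (shift F (Suc q) i) (diff F q i)"
  using res by (simp add: free_resolution_def)

lemma aug_surj: "au ` FM 0 = semigroup_ring m d"
  using res unfolding free_resolution_def by blast

lemma exact_0: "lin_ext (diff F 0) ` FM (Suc 0) = {v \<in> FM 0. au v = 0}"
  using res unfolding free_resolution_def One_nat_def by blast

lemma exact_Suc:
  "lin_ext (diff F (Suc q)) ` FM (Suc (Suc q)) = {v \<in> FM (Suc q). lin_ext (diff F q) v = 0}"
  using res unfolding free_resolution_def by blast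

lemma bd_in_free_module:
  assumes "v \<in> FM (Suc q)" shows "bd (Suc q) v \<in> FM q"
proof (cases q)
  case 0
  thus ?thesis using assms exact_0 by auto
next
  case (Suc r)
  thus ?thesis using assms exact_Suc[of r] by auto
qed

lemma bd_bd:
  assumes "v \<in> FM (Suc q)" shows "bd q (bd (Suc q) v) = 0"
proof (cases q)
  case (Suc r)
  thus ?thesis using assms exact_Suc[of r] by auto
qed simp

lemma aug_bd:
  assumes "v \<in> FM (Suc 0)" shows "au (bd (Suc 0) v) = 0"
  using assms exact_0 by auto

lemma bd_homogeneous:
  assumes "v \<in> FM (Suc q)" "hom (Suc q) c v" shows "hom q c (bd (Suc q) v)"
  using assms diff_homogeneous unfolding bd_simps
  by (intro homogeneous_lin_ext) (auto dest: free_moduleD)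

lemma exact_pos:
  assumes "v \<in> FM (Suc q)" "bd (Suc q) v = 0"
  shows "\<exists>w\<in>FM (Suc (Suc q)). bd (Suc (Suc q)) w = v"
proof -
  have "v \<in> lin_ext (diff F (Suc q)) ` FM (Suc (Suc q))" using assms unfolding exact_Suc by simp
  thus ?thesis by auto
qed

text \<open>
  The homology of \<open>F / (x\<^sub>u | u \<in> V) F\<close> vanishes in degree \<open>c\<close>.
\<close>

definition acyclic_mod :: "nat set \<Rightarrow> zvec \<Rightarrow> bool" where
  "acyclic_mod V c \<longleftrightarrow> (\<forall>p. \<forall>v\<in>FM p. hom p c v \<longrightarrow> bd p v \<in> var_submodule V \<longrightarrow>
     (\<exists>w\<in>FM (Suc p). hom (Suc p) c w \<and> v - bd (Suc p) w \<in> var_submodule V))"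

text \<open>The differential preserves degrees, so a preimage may be replaced by its component of
  degree \<open>c\<close>.\<close>

lemma homogeneous_preimage:
  assumes "hom p c v" "w \<in> FM (Suc p)" "v - bd (Suc p) w \<in> var_submodule V"
  shows "\<exists>w\<in>FM (Suc p). hom (Suc p) c w \<and> v - bd (Suc p) w \<in> var_submodule V"
proof -
  let ?w = "hom_comp m d (shift F (Suc p)) c w"
  have "hom_comp m d (shift F p) c (v - bd (Suc p) w) = v - bd (Suc p) ?w"
    using assms diff_homogeneous
    by (simp add: hom_comp_minus hom_comp_homogeneous[OF assms(1)] hom_comp_lin_ext[OF assms(2)])
  hence "v - bd (Suc p) ?w \<in> var_submodule V"
    using hom_comp_in_var_submodule[OF assms(3), of m d "shift F p" c] by simp
  thus ?thesis using assms(2) homogeneous_hom_comp free_module_hom_comp by blast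
qed

lemma exact_aug:
  assumes "v \<in> FM 0" "au v = 0" shows "\<exists>w\<in>FM (Suc 0). bd (Suc 0) w = v"
proof -
  have "v \<in> lin_ext (diff F 0) ` FM (Suc 0)" using assms unfolding exact_0 by blast
  thus ?thesis by auto
qed

text \<open>
  The long exact sequence of
  \<open>0 \<rightarrow> (F / V F)(- a\<^sup>u) \<rightarrow> F / V F \<rightarrow> F / (V \<union> {u}) F \<rightarrow> 0\<close>.
\<close>

lemma acyclic_mod_insert:
  assumes V: "acyclic_mod V c" "acyclic_mod V (c - gen m d u)"
    and u: "u \<notin> V" "u \<in> {1..ngens m d}"
  shows "acyclic_mod (insert u V) c"
  unfolding acyclic_mod_def
proof (intro allI ballI impI)
  fix p v
  assume v: "v \<in> FM p" "hom p c v" "bd p v \<in> var_submodule (insert u V)"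
  \<comment> \<open>Correct \<open>v\<close> by a multiple of \<open>x\<^sub>u\<close> to obtain a
    cycle modulo \<open>V\<close>.\<close>
  have "\<exists>z\<in>FM p. hom p (c - gen m d u) z \<and> bd p (v - smult (var u) z) \<in> var_submodule V"
  proof (cases p)
    case 0
    thus ?thesis
      by (intro bexI[of _ 0]) (auto simp: free_module_zero homogeneous_def var_submodule_zero)
  next
    case (Suc q)
    \<comment> \<open>\<open>y\<close> represents the image of the class of \<open>v\<close> under
      the connecting homomorphism.\<close>
    define y where "y = div_var u (bd p v)"
    have y: "y \<in> FM q" "hom q (c - gen m d u) y"
      using v bd_in_free_module bd_homogeneous
      by (auto simp: y_def Suc simp del: bd_simps intro: div_var_in_free_module homogeneous_div_var)
    have n: "bd p v - smult (var u) y \<in> var_submodule V"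
      unfolding y_def by (rule minus_var_div_var_in_var_submodule[OF v(3)])
    \<comment> \<open>Two successive differentials compose to zero, so \<open>x\<^sub>u\<close>
      times the boundary of \<open>y\<close> lies in \<open>V F\<close>; cancelling
      \<open>x\<^sub>u\<close> makes \<open>y\<close> a cycle modulo \<open>V\<close>.\<close>
    have "bd q (bd p v - smult (var u) y) = 0 - smult (var u) (bd q y)"
      using v(1) by (simp add: bd_minus bd_smult bd_bd Suc del: bd_simps)
    hence "0 - (0 - smult (var u) (bd q y)) \<in> var_submodule V"
      using bd_in_var_submodule[OF n, of q] by (metis var_submodule_minus var_submodule_zero)
    hence "smult (var u) (bd q y) \<in> var_submodule V" by simp
    hence "bd q y \<in> var_submodule V" using u(1) by (rule var_submodule_cancel_var)
    then obtain z where z: "z \<in> FM p" "hom p (c - gen m d u) z" "y - bd p z \<in> var_submodule V"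
      using V(2) y unfolding acyclic_mod_def Suc by blast
    have "smult (var u) (y - bd p z) \<in> var_submodule V"
      by (rule var_submodule_smult[OF z(3)])
    hence "(bd p v - smult (var u) y) + smult (var u) (y - bd p z) \<in> var_submodule V"
      by (rule var_submodule_add[OF n])
    moreover have "(bd p v - smult (var u) y) + smult (var u) (y - bd p z)
        = bd p (v - smult (var u) z)"
      by (intro poly_mapping_eqI) (simp add: bd_minus bd_smult lookup_add lookup_minus algebra_simps)
    ultimately show ?thesis using z by auto
  qed
  then obtain z where z: "z \<in> FM p" "hom p (c - gen m d u) z"
      "bd p (v - smult (var u) z) \<in> var_submodule V" by blast
  have "v - smult (var u) z \<in> FM p" "hom p c (v - smult (var u) z)"
    using v z u by (auto intro!: free_module_minus free_module_smult var_in_poly_ring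
        homogeneous_minus homogeneous_var_times)
  then obtain w where w: "w \<in> FM (Suc p)" "hom (Suc p) c w"
      "(v - smult (var u) z) - bd (Suc p) w \<in> var_submodule V"
    using V(1) z(3) unfolding acyclic_mod_def by blast
  \<comment> \<open>The correction \<open>x\<^sub>u z\<close> vanishes modulo
    \<open>insert u V\<close>.\<close>
  have "(v - smult (var u) z - bd (Suc p) w) + smult (var u) z \<in> var_submodule (insert u V)"
    using w(3) var_submodule_mono[of V "insert u V"]
    by (intro var_submodule_add var_times_in_var_submodule) auto
  hence "v - bd (Suc p) w \<in> var_submodule (insert u V)" by (simp add: algebra_simps)
  thus "\<exists>w\<in>FM (Suc p). hom (Suc p) c w \<and> v - bd (Suc p) w \<in> var_submodule (insert u V)"
    using w by blast
qed

lemma aug_map_var_times: "au (smult (var u) z) = single (gen m d u) 1 * au z"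
  by (simp add: aug_map_smult var_def mon_deg_single)

text \<open>
  Since \<open>x\<^sub>u\<close> is regular on the semigroup ring \<open>R\<close>, \<open>F / x\<^sub>u F\<close> resolves \<open>R / x\<^sub>u R\<close>, which vanishes
  in degree \<open>c\<close> by the assumption on \<open>c\<close>.
\<close>

lemma acyclic_mod_singleton:
  assumes u: "u \<in> {1..ngens m d}"
    and c: "c \<in> semigroup_gen m d \<Longrightarrow> c - gen m d u \<in> semigroup_gen m d"
  shows "acyclic_mod {u} c"
  unfolding acyclic_mod_def
proof (intro allI ballI impI)
  fix p v
  assume v: "v \<in> FM p" "hom p c v" "bd p v \<in> var_submodule {u}"
  \<comment> \<open>Homogeneity of the preimage is ignored here and restored at the end by
    \<open>homogeneous_preimage\<close>.\<close>
  have "\<exists>z\<in>FM p. \<exists>w\<in>FM (Suc p). v - smult (var u) z = bd (Suc p) w"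
  proof (cases p)
    case 0
    have k: "keys (au v) \<subseteq> {c}"
      using v shift_aug unfolding 0 by (intro aug_map_homogeneous)
    \<comment> \<open>The augmentation of \<open>v\<close> lives in degree \<open>c\<close> alone:
      either \<open>c\<close> is in the semigroup and the monomial is divisible by that of
      \<open>gen m d u\<close>, or this degree piece of the ring is zero.\<close>
    have "\<exists>z\<in>FM 0. au (smult (var u) z) = au v"
    proof (cases "c \<in> semigroup_gen m d")
      case True
      have "single (c - gen m d u) (lookup (au v) c) \<in> semigroup_ring m d"
        using c[OF True] by (simp add: semigroup_ring_def)
      then obtain z where z: "z \<in> FM 0" "au z = single (c - gen m d u) (lookup (au v) c)"
        using aug_surj by (metis imageE)
      have "au (smult (var u) z) = single c (lookup (au v) c)"
        by (simp add: aug_map_var_times z mult_single)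
      also have "\<dots> = au v"
        using k by (intro poly_mapping_eqI) (auto simp: lookup_single when_def in_keys_iff)
      finally show ?thesis using z(1) by blast
    next
      case False
      have "au v \<in> semigroup_ring m d" using v(1) aug_surj unfolding 0 by blast
      hence "keys (au v) = {}" using k False unfolding semigroup_ring_def by blast
      hence "au (smult (var u) 0) = au v" by (simp add: aug_map_var_times aug_map_def[of m d _ 0])
      thus ?thesis using free_module_zero by blast
    qed
    then obtain z where z: "z \<in> FM 0" "au (smult (var u) z) = au v" by blast
    have "v - smult (var u) z \<in> FM 0" "au (v - smult (var u) z) = 0"
      using v(1) z u by (auto simp: 0 aug_map_minus
          intro!: free_module_minus free_module_smult var_in_poly_ring)
    from exact_aug[OF this] show ?thesis using z(1) unfolding 0 by metis
  next
    case (Suc q)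
    define y where "y = div_var u (bd p v)"
    have y: "y \<in> FM q"
      using v bd_in_free_module by (auto simp: y_def Suc simp del: bd_simps intro: div_var_in_free_module)
    \<comment> \<open>Only \<open>x\<^sub>u\<close> is killed, so the remainder lies in
      \<open>var_submodule {}\<close> and division is exact.\<close>
    have n: "bd p v = smult (var u) y"
      using minus_var_div_var_in_var_submodule[OF v(3)]
      by (simp add: y_def var_submodule_empty)
    have "\<exists>z\<in>FM p. bd p z = y"
    proof (cases q)
      case 0
      have "au (bd p v) = 0" using aug_bd[of v] v(1) unfolding Suc 0 by simp
      hence "single (gen m d u) 1 * au y = 0" unfolding n aug_map_var_times .
      \<comment> \<open>Regularity of \<open>x\<^sub>u\<close> on the semigroup ring: its image is a
        unit of the surrounding group ring, where negative exponents are allowed.\<close>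
      hence "single (- gen m d u) 1 * (single (gen m d u) 1 * au y) = 0" by simp
      hence "au y = 0" by (simp add: mult_single flip: mult.assoc)
      with y show ?thesis using exact_aug[of y] by (simp add: 0 Suc)
    next
      case q: (Suc r)
      have "smult (var u) (bd q y) \<in> var_submodule {}"
        using bd_bd[of v q] v(1) by (simp add: var_submodule_empty Suc[symmetric] n bd_smult del: bd_simps)
      hence "bd q y \<in> var_submodule {}" by (rule var_submodule_cancel_var) simp
      thus ?thesis using exact_pos[of y r] y by (simp add: var_submodule_empty q Suc del: bd_simps)
    qed
    then obtain z where z: "z \<in> FM p" "bd p z = y" by blast
    have "v - smult (var u) z \<in> FM p" "bd p (v - smult (var u) z) = 0"
      using v(1) z u by (auto simp: bd_minus bd_smult n simp del: bd_simps
          intro!: free_module_minus free_module_smult var_in_poly_ring)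
    hence "\<exists>w\<in>FM (Suc p). bd (Suc p) w = v - smult (var u) z"
      using exact_pos[of _ q] unfolding Suc by blast
    thus ?thesis using z(1) by metis
  qed
  then obtain z w where z: "z \<in> FM p" "w \<in> FM (Suc p)" "v - smult (var u) z = bd (Suc p) w"
    by blast
  have "v - bd (Suc p) w = smult (var u) z" by (simp add: algebra_simps flip: z(3) del: bd_simps)
  hence "v - bd (Suc p) w \<in> var_submodule {u}" by (simp add: var_times_in_var_submodule del: bd_simps)
  thus "\<exists>w\<in>FM (Suc p). hom (Suc p) c w \<and> v - bd (Suc p) w \<in> var_submodule {u}"
    using homogeneous_preimage[OF v(2) z(2)] by blast
qed

text \<open>Adjoining \<open>x\<close> to \<open>V\<close> requires acyclicity in degrees
  \<open>c\<close> and \<open>c - gen m d x\<close>. A subset \<open>I\<close> of \<open>V\<close>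
  in the second degree gives the condition for \<open>insert x I\<close> in the first.\<close>

lemma acyclic_mod_cone:
  assumes "finite V" "insert u V \<subseteq> {1..ngens m d}" "u \<notin> V"
    and "\<And>I. I \<subseteq> V \<Longrightarrow> c - (\<Sum>i\<in>I. gen m d i) \<in> semigroup_gen m d
      \<Longrightarrow> c - (\<Sum>i\<in>I. gen m d i) - gen m d u \<in> semigroup_gen m d"
  shows "acyclic_mod (insert u V) c"
  using assms
proof (induction V arbitrary: c rule: finite_induct)
  case empty
  show ?case by (rule acyclic_mod_singleton) (use empty in auto)
next
  case (insert x V)
  have "acyclic_mod (insert x (insert u V)) c"
  proof (rule acyclic_mod_insert)
    show "acyclic_mod (insert u V) c"
      by (rule insert.IH) (use insert.prems in auto)
    show "acyclic_mod (insert u V) (c - gen m d x)"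
    proof (rule insert.IH)
      fix I assume I: "I \<subseteq> V"
        and a: "c - gen m d x - (\<Sum>i\<in>I. gen m d i) \<in> semigroup_gen m d"
      have "finite I" "x \<notin> I" using I insert.hyps finite_subset by auto
      hence eq: "c - gen m d x - (\<Sum>i\<in>I. gen m d i) = c - (\<Sum>i\<in>insert x I. gen m d i)"
        by simp
      show "c - gen m d x - (\<Sum>i\<in>I. gen m d i) - gen m d u \<in> semigroup_gen m d"
        unfolding eq by (rule insert.prems(3)) (use I a eq in auto)
    qed (use insert.prems in auto)
  qed (use insert in auto)
  thus ?case by (simp add: insert_commute)
qed

section \<open>Reduction of the resolution to \<open>k\<close>\<close>

lemma lookup_diff_k:
  assumes "\<And>i. lookup (lookup v i) 0 = lookup z i"
  shows "lookup (lookup (bd (Suc q) v) l) 0 = lookup (diff_k F q z) l"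
proof -
  have "keys z \<subseteq> keys v"
  proof
    fix i assume "i \<in> keys z"
    hence "lookup (lookup v i) 0 \<noteq> 0" unfolding assms by (simp add: in_keys_iff)
    thus "i \<in> keys v" by (auto simp: in_keys_iff)
  qed
  hence "diff_k F q z
      = (\<Sum>i\<in>keys v. smult (lookup z i) (Poly_Mapping.map (\<lambda>f. lookup f 0) (diff F q i)))"
    unfolding diff_k_def by (intro lin_ext_superset) simp_all
  hence "lookup (diff_k F q z) l = (\<Sum>i\<in>keys v. lookup z i * lookup (lookup (diff F q i) l) 0)"
    by (simp only: lookup_sum lookup_smult Poly_Mapping.map.rep_eq when_def) (intro sum.cong refl, simp)
  thus ?thesis by (simp only: bd_simps lookup_lin_ext lookup_sum lookup_mult_zero assms)
qed

text \<open>Modulo all variables only constant terms survive. A cycle over \<open>k\<close> lifts to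
  constant polynomials, acyclicity supplies a preimage, and its constant terms form the required
  chain.\<close>

lemma cycles_subset_boundaries:
  assumes "acyclic_mod {1..ngens m d} b"
  shows "cycles_k F p b \<subseteq> boundaries_k F p b"
proof
  fix z assume z: "z \<in> cycles_k F p b"
  hence kz: "keys z \<subseteq> {i \<in> basis F p. shift F p i = b}" and dz: "p \<noteq> 0 \<Longrightarrow> diff_k F (p - 1) z = 0"
    by (auto simp: cycles_k_def chains_k_def)
  define v where "v = Poly_Mapping.map (single (0 :: nat \<Rightarrow>\<^sub>0 nat)) z"
  have v: "lookup v i = single 0 (lookup z i)" for i
    by (simp add: v_def Poly_Mapping.map.rep_eq when_def)
  have "keys v \<subseteq> keys z"
  proof
    fix i assume "i \<in> keys v"
    hence "single (0 :: nat \<Rightarrow>\<^sub>0 nat) (lookup z i) \<noteq> 0" unfolding in_keys_iff v .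
    thus "i \<in> keys z" unfolding in_keys_iff by (metis single_zero)
  qed
  hence vF: "v \<in> FM p" using kz by (intro free_moduleI) (auto simp: v poly_ring_const)
  have vh: "hom p b v"
    unfolding homogeneous_iff
  proof (intro allI impI)
    fix i t assume "lookup (lookup v i) t \<noteq> 0"
    hence "t = 0" "i \<in> keys z"
      unfolding v by (auto simp: lookup_single when_def in_keys_iff split: if_splits)
    thus "mon_deg m d t + shift F p i = b" using kz by auto
  qed
  have "bd p v \<in> var_submodule {1..ngens m d}"
  proof (cases p)
    case 0
    thus ?thesis by (simp add: var_submodule_zero)
  next
    case (Suc q)
    have "lookup (lookup v i) 0 = lookup z i" for i by (simp add: v)
    from lookup_diff_k[OF this] have "lookup (lookup (bd p v) l) 0 = 0" for l
      unfolding Suc using dz unfolding Suc by simp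
    thus ?thesis
      using bd_in_free_module[of v q] vF unfolding Suc by (intro var_submoduleI)
  qed
  then obtain w where w: "w \<in> FM (Suc p)" "hom (Suc p) b w"
      "v - bd (Suc p) w \<in> var_submodule {1..ngens m d}"
    using assms vF vh unfolding acyclic_mod_def by blast
  define y where "y = Poly_Mapping.map (\<lambda>f. lookup f 0) w"
  have y: "lookup y i = lookup (lookup w i) 0" for i
    by (simp add: y_def Poly_Mapping.map.rep_eq when_def)
  have "z = diff_k F p y"
  proof (rule poly_mapping_eqI)
    fix l
    have "lookup (lookup (v - bd (Suc p) w) l) 0 = 0"
      using w(3) unfolding var_submodule_def mem_Collect_eq by (metis keys_zero inf_bot_left)
    hence "lookup z l = lookup (lookup (bd (Suc p) w) l) 0"
      by (simp add: lookup_minus v del: bd_simps)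
    thus "lookup z l = lookup (diff_k F p y) l"
      by (subst (asm) lookup_diff_k[of _ y]) (simp_all add: y)
  qed
  moreover have "y \<in> chains_k F (Suc p) b"
    unfolding chains_k_def
  proof (intro CollectI subsetI conjI)
    fix i assume "i \<in> keys y"
    hence n: "lookup (lookup w i) 0 \<noteq> 0" by (simp add: in_keys_iff y)
    hence "i \<in> keys w" by (auto simp: in_keys_iff)
    thus "i \<in> basis F (Suc p)" by (rule free_moduleD(1)[OF w(1)])
    \<comment> \<open>A constant term has degree 0, so homogeneity forces the basis element itself
      into degree \<open>b\<close>.\<close>
    have "mon_deg m d 0 + shift F (Suc p) i = b" using w(2) n unfolding homogeneous_iff by blast
    thus "shift F (Suc p) i = b" by simp
  qed
  ultimately show "z \<in> boundaries_k F p b" unfolding boundaries_k_def by (rule image_eqI)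
qed

end

text \<open>A nonempty \<open>X\<close> would contain some \<open>y \<in> B\<close>, and the
  coefficient vector supported at \<open>y\<close> is a nontrivial relation modulo
  \<open>B\<close>.\<close>

lemma quotient_dim_eq_0:
  fixes Z B :: "('i \<Rightarrow>\<^sub>0 'k::field) set"
  assumes "Z \<subseteq> B" shows "quotient_dim Z B = 0"
proof -
  have "enat (card X) = 0" if X: "finite X" "X \<subseteq> Z"
    "\<forall>c. (\<Sum>x\<in>X. smult (c x) x) \<in> B \<longrightarrow> (\<forall>x\<in>X. c x = 0)" for X
  proof (rule ccontr)
    assume "enat (card X) \<noteq> 0"
    then obtain y where y: "y \<in> X" by (cases "X = {}") (auto simp: zero_enat_def)
    have "(\<Sum>x\<in>X. smult (if x = y then 1 else 0) x) = (\<Sum>x\<in>X. if x = y then y else 0)"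
      by (intro sum.cong poly_mapping_eqI) auto
    also have "\<dots> = y" using X(1) y by simp
    finally have "(\<Sum>x\<in>X. smult (if x = y then 1 else 0) x) \<in> B" using y X(2) assms by auto
    with spec[OF X(3), of "\<lambda>x. if x = y then 1 else 0"]
    have "\<forall>x\<in>X. (if x = y then 1 else 0 :: 'k) = 0" by (rule mp)
    thus False using y by auto
  qed
  hence "quotient_dim Z B \<le> Sup {0 :: enat}"
    unfolding quotient_dim_def by (intro Sup_subset_mono) blast
  thus ?thesis by simp
qed


subsection \<open>The combinatorics of the degree\<close>

text \<open>Exchange argument with threshold \<open>f (card I)\<close>: elements of \<open>I\<close>
  beyond the initial segment have values at most this, the equally many missing elements of the
  segment at least this.\<close>

lemma sum_antimono_le_initial:
  fixes f :: "nat \<Rightarrow> int"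
  assumes I: "I \<subseteq> {1..n}" and f: "\<And>i k. 1 \<le> i \<Longrightarrow> i \<le> k \<Longrightarrow> k \<le> n \<Longrightarrow> f k \<le> f i"
  shows "sum f I \<le> sum f {1..card I}"
proof -
  let ?T = "{1..card I}"
  have fin: "finite I" using I finite_subset by blast
  have n: "card I \<le> n" using card_mono[OF _ I] by simp
  have c: "card (I - ?T) = card (?T - I)"
    using card_Diff_subset_Int[of I ?T] card_Diff_subset_Int[of ?T I] fin by (simp add: Int_commute)
  have "sum f (I - ?T) \<le> of_nat (card (I - ?T)) * f (card I)"
  proof (cases "I = {}")
    case False
    hence "1 \<le> card I" using fin by (simp add: Suc_le_eq card_gt_0_iff)
    thus ?thesis using I by (intro sum_bounded_above f) auto
  qed simp
  also have "\<dots> \<le> sum f (?T - I)"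
    unfolding c using n by (intro sum_bounded_below f) auto
  finally show ?thesis
    using sum.Int_Diff[of I f ?T] sum.Int_Diff[of ?T f I] fin by (simp add: Int_commute)
qed

section \<open>The lexicographic list of generators\<close>

lemma lookup_0_mono:
  fixes a c :: zvec
  assumes "a \<le> c" shows "lookup a 0 \<le> lookup c 0"
proof (cases "a = c")
  case False
  hence "a < c" using assms by simp
  \<comment> \<open>\<open>k\<close> is the first position of difference; for \<open>k > 0\<close>
    the coordinates at 0 agree.\<close>
  then obtain k where "lookup a k < lookup c k" "\<And>l. l < k \<Longrightarrow> lookup a l = lookup c l"
    by (auto simp: less_poly_mapping.rep_eq less_fun_def)
  thus ?thesis by (cases k) (auto simp: less_imp_le)
qed simp

lemma gen_antimono:
  assumes "1 \<le> i" "i \<le> k" "k \<le> ngens m d"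
  shows "gen m d k \<le> gen m d i"
proof -
  let ?l = "sorted_list_of_set (gens m d)"
  have "length ?l = ngens m d" by (simp add: ngens_def)
  thus ?thesis using assms unfolding gen_def
    by (auto simp: rev_nth intro!: sorted_nth_mono)
qed

text \<open>The list enumerates a set with as many elements as there are indices.\<close>

lemma inj_on_gen: "inj_on (gen m d) {1..ngens m d}"
  by (rule eq_card_imp_inj_on) (simp_all only: gen_image, simp_all add: ngens_def)

lemma coord_sum_add: "coord_sum m (a + c) = coord_sum m a + coord_sum m c"
  by (simp add: coord_sum_def lookup_add sum.distrib)

lemma coord_sum_minus: "coord_sum m (a - c) = coord_sum m a - coord_sum m c"
  by (simp add: coord_sum_def lookup_minus sum_subtractf)

lemma coord_sum_sum: "coord_sum m (\<Sum>i\<in>I. f i) = (\<Sum>i\<in>I. coord_sum m (f i))"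
  unfolding coord_sum_def lookup_sum by (rule sum.swap)

lemma lookup_le_coord_sum:
  assumes "\<And>i. 0 \<le> lookup a i" "i \<le> m" shows "lookup a i \<le> coord_sum m a"
  unfolding coord_sum_def using assms by (intro member_le_sum) auto

lemma gens_eq_single_0:
  assumes a: "a \<in> gens m d" "int d \<le> lookup a 0" shows "a = single 0 (int d)"
proof -
  have nn: "0 \<le> lookup a i" for i using a(1) by (simp add: gens_def)
  have z: "lookup a i = 0" if "i \<noteq> 0" for i
  proof (cases "i \<le> m")
    case True
    have "lookup a 0 + lookup a i = sum (lookup a) {0, i}" using that by simp
    also have "\<dots> \<le> coord_sum m a"
      unfolding coord_sum_def using True nn by (intro sum_mono2) auto
    finally have "lookup a 0 + lookup a i \<le> int d" using a(1) by (simp add: gens_def)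
    thus ?thesis using a(2) nn[of i] by linarith
  next
    case False
    thus ?thesis using a(1) by (auto simp: gens_def zlattice_def in_keys_iff)
  qed
  have "coord_sum m a = lookup a 0"
    unfolding coord_sum_def using z by (subst sum.mono_neutral_right[of _ "{0}"]) auto
  hence "lookup a 0 = int d" using a(1) by (simp add: gens_def)
  with z have "lookup a i = (int d when 0 = i)" for i by (cases "i = 0") simp_all
  thus ?thesis by (intro poly_mapping_eqI) (simp only: lookup_single)
qed

lemma coord_sum_single: "i \<le> m \<Longrightarrow> coord_sum m (single i x) = x"
  by (simp add: coord_sum_def lookup_single when_def)

lemma zlattice_single: "i \<le> m \<Longrightarrow> single i x \<in> zlattice m"
  by (simp add: zlattice_def)

lemma single_in_gens: "i \<le> m \<Longrightarrow> single i (int d) \<in> gens m d"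
  by (auto simp: gens_def zlattice_single coord_sum_single lookup_single when_def)

text \<open>Coordinate 0 is antitone along the list and attains \<open>d\<close> at some index
  \<open>k\<close>, so it is at least \<open>d\<close> at index 1, which determines the
  generator.\<close>

lemma gen_1: "gen m d 1 = single 0 (int d)" and ngens_pos: "1 \<le> ngens m d"
proof -
  obtain k where k: "k \<in> {1..ngens m d}" "gen m d k = single 0 (int d)"
  proof -
    have "single 0 (int d) \<in> gen m d ` {1..ngens m d}"
      unfolding gen_image by (rule single_in_gens) simp
    thus ?thesis using that by (elim imageE) simp
  qed
  thus p: "1 \<le> ngens m d" by simp
  have "lookup (gen m d k) 0 \<le> lookup (gen m d 1) 0"
    using k by (intro lookup_0_mono gen_antimono) auto
  hence "int d \<le> lookup (gen m d 1) 0" unfolding k lookup_single_eq .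
  moreover have "gen m d 1 \<in> gens m d" using p by (intro gen_in_gens) simp
  ultimately show "gen m d 1 = single 0 (int d)" by (rule gens_eq_single_0[rotated])
qed

lemma lookup_gen_1: "lookup (gen m d (Suc 0)) i = (int d when i = 0)"
  unfolding gen_1[unfolded One_nat_def] lookup_single when_def by auto

lemma lookup_gen_less:
  assumes "i \<in> {2..ngens m d}" shows "lookup (gen m d i) 0 < int d"
proof (rule ccontr)
  assume "\<not> lookup (gen m d i) 0 < int d"
  moreover have "gen m d i \<in> gens m d" using assms by (intro gen_in_gens) auto
  ultimately have "gen m d i = gen m d 1" unfolding gen_1 by (intro gens_eq_single_0) auto
  hence "i = 1" using inj_onD[OF inj_on_gen, of m d i 1] assms by simp
  thus False using assms by simp
qed

section \<open>Lattice description of the semigroup\<close>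

lemma ex_subvector:
  assumes c: "c \<in> zlattice m" "\<And>i. 0 \<le> lookup c i" "int e \<le> coord_sum m c"
  shows "\<exists>a\<in>zlattice m. (\<forall>i. 0 \<le> lookup a i \<and> lookup a i \<le> lookup c i) \<and> coord_sum m a = int e"
  using c(3)
proof (induction e)
  case 0
  show ?case using c by (intro bexI[of _ 0]) (auto simp: coord_sum_def zlattice_def)
next
  case (Suc e)
  hence "int e \<le> coord_sum m c" by simp
  from Suc.IH[OF this] obtain a where a: "a \<in> zlattice m" "\<And>i. 0 \<le> lookup a i"
      "\<And>i. lookup a i \<le> lookup c i" "coord_sum m a = int e" by blast
  \<comment> \<open>While the coordinate sum of \<open>a\<close> is below that of \<open>c\<close>,
    some coordinate has slack and can be raised by 1.\<close>
  have "\<exists>i\<le>m. lookup a i < lookup c i"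
  proof (rule ccontr)
    assume "\<not> ?thesis"
    hence "coord_sum m c \<le> coord_sum m a" unfolding coord_sum_def by (intro sum_mono) force
    thus False using Suc.prems a by simp
  qed
  then obtain i where i: "i \<le> m" "lookup a i < lookup c i" by blast
  show ?case
    using a i by (intro bexI[of _ "a + single i 1"])
      (auto simp: coord_sum_add coord_sum_single zlattice_add zlattice_single lookup_add
        lookup_single when_def)
qed

lemma zlattice_minus: "a \<in> zlattice m \<Longrightarrow> c \<in> zlattice m \<Longrightarrow> a - c \<in> zlattice m"
  using keys_diff[of a c] unfolding zlattice_def by blast

text \<open>Peel off one generator below \<open>c\<close> at a time; each lowers the coordinate sum
  by \<open>d\<close>.\<close>

lemma semigroup_genI:
  assumes "c \<in> zlattice m" "\<And>i. 0 \<le> lookup c i" "coord_sum m c = int (d * l)"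
  shows "c \<in> semigroup_gen m d"
  using assms
proof (induction l arbitrary: c)
  case 0
  have "lookup c i = 0" for i
  proof (cases "i \<le> m")
    case True
    thus ?thesis using lookup_le_coord_sum[of c i m] 0 by (simp add: antisym)
  next
    case False
    thus ?thesis using 0(1) by (auto simp: zlattice_def in_keys_iff)
  qed
  hence "c = 0" by (intro poly_mapping_eqI) simp
  thus ?case by (simp add: semigroup_gen.zero)
next
  case (Suc l)
  have "int d \<le> coord_sum m c" using Suc.prems(3) by simp
  from ex_subvector[OF Suc.prems(1,2) this] obtain a where a: "a \<in> zlattice m"
      "\<And>i. 0 \<le> lookup a i" "\<And>i. lookup a i \<le> lookup c i" "coord_sum m a = int d" by blast
  have "c - a \<in> semigroup_gen m d"
    by (rule Suc.IH)
       (use a Suc.prems in \<open>auto simp: zlattice_minus lookup_minus coord_sum_minus algebra_simps\<close>)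
  hence "a + (c - a) \<in> semigroup_gen m d"
    by (intro semigroup_gen.add) (use a in \<open>auto simp: gens_def\<close>)
  thus ?case by simp
qed

lemma semigroup_gen_nonneg: "c \<in> semigroup_gen m d \<Longrightarrow> 0 \<le> lookup c i"
  by (induction rule: semigroup_gen.induct) (auto simp: lookup_add gens_def)

text \<open>
  The squarefree divisor complex \<open>{I. b - a\<^sup>I \<in> \<nat>A}\<close> is a cone with apex \<open>1\<close>: adding \<open>a\<^sup>1 = (d, 0, \<dots>, 0)\<close>
  only affects coordinate \<open>0\<close>, where the bound on \<open>b\<^sub>0\<close> leaves enough room for any \<open>j\<close> generators.
  A face \<open>I\<close> with \<open>j\<close> elements has sum \<open>b\<close>, so that exchanging one of its elements for \<open>1\<close>
  would exceed that bound.
\<close>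

lemma divisor_complex_cone:
  assumes d: "d > 0"
    and b: "coord_sum m b = int (d * j)"
      "lookup b 0 \<ge> (\<Sum>i = 1..min j (ngens m d). lookup (gen m d i) 0)"
    and I: "I \<subseteq> {2..ngens m d}" "b - (\<Sum>i\<in>I. gen m d i) \<in> semigroup_gen m d" and j: "j \<ge> 1"
  shows "b - (\<Sum>i\<in>I. gen m d i) - gen m d 1 \<in> semigroup_gen m d"
proof -
  let ?n = "ngens m d" and ?f = "\<lambda>i. lookup (gen m d i) 0"
  let ?c = "b - (\<Sum>i\<in>I. gen m d i)"
  have fin: "finite I" using I(1) finite_subset by blast
  have I1: "I \<subseteq> {1..?n}" "1 \<notin> I" using I(1) by auto
  have g: "gen m d i \<in> gens m d" if "i \<in> I" for i
    using that I1 by (intro gen_in_gens) blast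
  have initial: "sum ?f J \<le> sum ?f {1..card J}" if "J \<subseteq> {1..?n}" for J
    using that by (rule sum_antimono_le_initial) (intro lookup_0_mono gen_antimono)
  have f0: "0 \<le> ?f i" if "i \<in> {1..?n}" for i
    using gen_in_gens[OF that] by (simp add: gens_def)
  have c0: "lookup ?c 0 = lookup b 0 - sum ?f I" by (simp add: lookup_minus lookup_sum)
  have cnn: "0 \<le> lookup ?c i" for i using I(2) by (rule semigroup_gen_nonneg)
  have "coord_sum m (\<Sum>i\<in>I. gen m d i) = (\<Sum>i\<in>I. int d)"
    unfolding coord_sum_sum using g by (intro sum.cong) (auto simp: gens_def)
  hence cs: "coord_sum m ?c = int d * (int j - int (card I))"
    by (simp add: coord_sum_minus b(1) algebra_simps)
  have "0 \<le> coord_sum m ?c" unfolding coord_sum_def by (intro sum_nonneg cnn)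
  hence le: "card I \<le> j" using d unfolding cs by (simp add: zero_le_mult_iff)
  have "card I \<noteq> j"
  proof
    assume eq: "card I = j"
    \<comment> \<open>With \<open>j\<close> generators removed the coordinate sum is 0, leaving
      nothing in coordinate 0.\<close>
    hence "lookup ?c 0 \<le> 0" using lookup_le_coord_sum[OF cnn, of 0 m] cs by simp
    hence "lookup b 0 \<le> sum ?f I" unfolding c0 by simp
    moreover obtain x where x: "x \<in> I" using eq j fin by fastforce
    let ?J = "insert 1 (I - {x})"
    \<comment> \<open>Strict because \<open>gen m d 1\<close> alone attains \<open>d\<close> in
      coordinate 0.\<close>
    have "sum ?f I < sum ?f ?J"
      using x I(1) I1 lookup_gen_less[of x m d] fin
      by (auto simp: sum.remove[OF fin x] lookup_gen_1)
    moreover have "card ?J = j" using x I1 fin eq j by (simp add: card_Diff_singleton)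
    moreover have "?J \<subseteq> {1..?n}" using I1 ngens_pos[of m d] by auto
    hence "sum ?f ?J \<le> sum ?f {1..card ?J}" by (rule initial)
    moreover have "min j ?n = j" using card_mono[OF _ I1(1)] eq by simp
    ultimately show False using b(2) by simp
  qed
  hence lt: "card I < j" using le by simp
  \<comment> \<open>As \<open>card I < j\<close>, the enlarged set has at most
    \<open>min j ?n\<close> elements, so its coordinate-0 sum is within the bound.\<close>
  have "?f 1 + sum ?f I = sum ?f (insert 1 I)" using fin I1 by simp
  also have "\<dots> \<le> sum ?f {1..card (insert 1 I)}"
    using I1 ngens_pos[of m d] by (intro initial) auto
  also have "\<dots> \<le> sum ?f {1..min j ?n}"
  proof (rule sum_mono2)
    have "card (insert 1 I) \<le> ?n"
      using card_mono[of "{1..?n}" "insert 1 I"] I1 ngens_pos[of m d] by auto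
    moreover have "card (insert 1 I) \<le> j" using lt fin I1 by simp
    ultimately show "{1..card (insert 1 I)} \<subseteq> {1..min j ?n}" by auto
  qed (auto intro: f0)
  finally have room: "?f 1 \<le> lookup ?c 0" using b(2) unfolding c0 by simp
  show ?thesis
  proof (rule semigroup_genI)
    show "?c - gen m d 1 \<in> zlattice m"
      unfolding gen_1 by (rule zlattice_minus[OF semigroup_gen_zlattice[OF I(2)] zlattice_single]) simp
    show "0 \<le> lookup (?c - gen m d 1) i" for i
      using room cnn[of i] by (cases "i = 0") (simp_all add: lookup_minus lookup_gen_1)
    \<comment> \<open>The truncated subtraction is exact because \<open>card I < j\<close>.\<close>
    show "coord_sum m (?c - gen m d 1) = int (d * (j - card I - 1))"
    proof -
      have "int (j - card I - 1) = int j - int (card I) - 1" using lt by simp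
      thus ?thesis unfolding coord_sum_minus[of m ?c] cs gen_1 coord_sum_single[OF le0] of_nat_mult
        by (simp only: right_diff_distrib mult_1_right)
    qed
  qed
qed

theorem theorem1p1:
  fixes m d j :: nat and b :: zvec
  assumes "d \<ge> 2" and "m \<ge> 2" and "j \<ge> 1"
    and "b \<in> semigroup_gen m d" and "coord_sum m b = int (d * j)"
    and "lookup b 0 \<ge> (\<Sum>i = 1..min j (ngens m d). lookup (gen m d i) 0)"
  shows "\<forall>p :: int. multigraded_betti TYPE('k::field) m d p b = 0"
proof -
  define F where "F = (SOME F :: 'k free_complex. free_resolution m d F)"
  interpret resolution m d F
    by unfold_locales (unfold F_def, rule someI_ex[OF ex_free_resolution])
  \<comment> \<open>The apex \<open>x\<^sub>1\<close> is killed first, then the other variables; the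
    degree condition for each \<open>I\<close> is \<open>divisor_complex_cone\<close>.\<close>
  have "acyclic_mod (insert 1 {2..ngens m d}) b"
  proof (rule acyclic_mod_cone)
    show "insert 1 {2..ngens m d} \<subseteq> {1..ngens m d}" using ngens_pos[of m d] by auto
  qed (use assms in \<open>auto intro: divisor_complex_cone[where j = j, unfolded One_nat_def]\<close>)
  moreover have "insert 1 {2..ngens m d} = {1..ngens m d}" using ngens_pos[of m d] by auto
  ultimately have "tor_dim F q b = 0" for q
    unfolding tor_dim_def by (intro quotient_dim_eq_0 cycles_subset_boundaries) simp
  thus ?thesis by (simp add: multigraded_betti_def F_def)
qed

end
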